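(* Let $(\mathcal{V},\circ,\langle\cdot,\cdot\rangle)$ be a Euclidean Jordan algebra of rank $n$ and let $a,b\in\mathcal{V}$ with $a\geq 0$ and $b\geq 0$. Then $$\lambda\big(P_{\sqrt{a}}(b)\big)\underset{\log}{\prec}\lambda(a)*\lambda(b).$$ Consequently, $\lambda\big(P_{\sqrt{a}}(b)\big)\underset{w}{\prec}\lambda(a)*\lambda(b)$.
   Context: A Euclidean Jordan algebra $(\mathcal{V},\circ,\langle\cdot,\cdot\rangle)$ is a finite-dimensional real inner product space with a commutative bilinear product $\circ$ satisfying $x\circ(x^2\circ y)=x^2\circ(x\circ y)$ and $\langle x\circ y,z\rangle=\langle y,x\circ z\rangle$ (where $x^2=x\circ x$), with unit element $e$. A Jordan frame is a set $\{e_1,\dots,e_n\}$ of primitive idempotents with $e_i\circ e_j=0$ for $i\neq j$ and $\sum_i e_i=e$; the number $n$ is the rank of $\mathcal{V}$. Every $x\in\mathcal{V}$ has a spectral decomposition $x=x_1e_1+\cdots+x_ne_n$ for some Jordan frame $\{e_1,\dots,e_n\}$, with the real numbers $x_i$ (the eigenvalues of $x$) uniquely determined up to order. $\lambda(x)=(\lambda_1(x),\dots,\lambda_n(x))\in\mathbb{R}^n$ denotes the vector of eigenvalues of $x$ in decreasing order. $x\geq 0$ means all eigenvalues of $x$ are nonnegative; then $\sqrt{x}:=\sum_i\sqrt{x_i}\,e_i$. The inner product is the trace inner product $\langle x,y\rangle=\operatorname{tr}(x\circ y)$, where $\operatorname{tr}$ is the sum of eigenvalues. The quadratic representation of $a$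 is $P_a(x):=2\,a\circ(a\circ x)-a^2\circ x$. For $p,q\in\mathbb{R}^n$, $p*q$ is the componentwise product and $p^\downarrow$ is the decreasing rearrangement of $p$. $p\underset{w}{\prec}q$ means $\sum_{i=1}^k p_i^\downarrow\leq\sum_{i=1}^k q_i^\downarrow$ for all $1\leq k\leq n$. For vectors with nonnegative entries, $p\underset{\log}{\prec}q$ means $\prod_{i=1}^k p_i^\downarrow\leq\prod_{i=1}^k q_i^\downarrow$ for all $1\leq k\leq n$, with equality for $k=n$. *)

theory Defs
  imports "HOL-Analysis.Analysis" "HOL-Library.Multiset"
begin

text \<open>The underlying real inner product space is the type itself, with inner product
  \<open>x \<bullet> y\<close>; class \<open>euclidean_space\<close> makes it finite-dimensional and nonzero.\<close>

locale euclidean_jordan_algebra =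
  fixes jp :: "'a::euclidean_space \<Rightarrow> 'a \<Rightarrow> 'a"  (infixl "\<odot>" 70)
    and e :: 'a
  assumes bilinear: "bilinear (\<odot>)"
    and commute: "x \<odot> y = y \<odot> x"
    and jordan: "x \<odot> ((x \<odot> x) \<odot> y) = (x \<odot> x) \<odot> (x \<odot> y)"
    and inner_assoc: "inner (x \<odot> y) z = inner y (x \<odot> z)"
    and unit: "e \<odot> x = x"

definition idempotent :: "('a::euclidean_space \<Rightarrow> 'a \<Rightarrow> 'a) \<Rightarrow> 'a \<Rightarrow> bool" where
  "idempotent jp c \<longleftrightarrow> jp c c = c"

text \<open>Orthogonality of the two summands need not be demanded: if \<open>c\<close>, \<open>u\<close>, \<open>v\<close> are idempotent
  and \<open>c = u + v\<close>, then squaring gives \<open>jp u v = 0\<close>.\<close>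

definition primitive_idempotent :: "('a::euclidean_space \<Rightarrow> 'a \<Rightarrow> 'a) \<Rightarrow> 'a \<Rightarrow> bool" where
  "primitive_idempotent jp c \<longleftrightarrow>
     idempotent jp c \<and> c \<noteq> 0 \<and>
     \<not> (\<exists>u v. idempotent jp u \<and> idempotent jp v \<and> u \<noteq> 0 \<and> v \<noteq> 0 \<and> c = u + v)"

definition jordan_frame :: "('a::euclidean_space \<Rightarrow> 'a \<Rightarrow> 'a) \<Rightarrow> 'a \<Rightarrow> 'a set \<Rightarrow> bool" where
  "jordan_frame jp e F \<longleftrightarrow>
     finite F \<and> (\<forall>c\<in>F. primitive_idempotent jp c) \<and>
     (\<forall>c\<in>F. \<forall>d\<in>F. c \<noteq> d \<longrightarrow> jp c d = 0) \<and> \<Sum>F = e"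

text \<open>In a Euclidean Jordan algebra all Jordan frames have the same cardinality, every element
  has a spectral decomposition, and the eigenvalue multiset and the square root do not depend on
  the decomposition chosen; this is what makes the definite descriptions below meaningful.\<close>

definition jordan_rank :: "('a::euclidean_space \<Rightarrow> 'a \<Rightarrow> 'a) \<Rightarrow> 'a \<Rightarrow> nat" where
  "jordan_rank jp e = (THE n. \<exists>F. jordan_frame jp e F \<and> card F = n)"

definition spectral_decomposition ::
  "('a::euclidean_space \<Rightarrow> 'a \<Rightarrow> 'a) \<Rightarrow> 'a \<Rightarrow> 'a \<Rightarrow> 'a set \<Rightarrow> ('a \<Rightarrow> real) \<Rightarrow> bool" where
  "spectral_decomposition jp e x F r \<longleftrightarrow> jordan_frame jp e F \<and> x = (\<Sum>c\<in>F. r c *\<^sub>R c)"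

definition eigenvalues :: "('a::euclidean_space \<Rightarrow> 'a \<Rightarrow> 'a) \<Rightarrow> 'a \<Rightarrow> 'a \<Rightarrow> real multiset" where
  "eigenvalues jp e x =
     (THE M. \<exists>F r. spectral_decomposition jp e x F r \<and> M = image_mset r (mset_set F))"

definition jordan_trace :: "('a::euclidean_space \<Rightarrow> 'a \<Rightarrow> 'a) \<Rightarrow> 'a \<Rightarrow> 'a \<Rightarrow> real" where
  "jordan_trace jp e x = sum_mset (eigenvalues jp e x)"

definition jordan_nonneg :: "('a::euclidean_space \<Rightarrow> 'a \<Rightarrow> 'a) \<Rightarrow> 'a \<Rightarrow> 'a \<Rightarrow> bool" where
  "jordan_nonneg jp e x \<longleftrightarrow> (\<forall>t \<in># eigenvalues jp e x. 0 \<le> t)"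

text \<open>Only meant for \<open>x\<close> with \<open>jordan_nonneg jp e x\<close>.\<close>

definition jordan_sqrt :: "('a::euclidean_space \<Rightarrow> 'a \<Rightarrow> 'a) \<Rightarrow> 'a \<Rightarrow> 'a \<Rightarrow> 'a" where
  "jordan_sqrt jp e x =
     (THE y. \<exists>F r. spectral_decomposition jp e x F r \<and> y = (\<Sum>c\<in>F. sqrt (r c) *\<^sub>R c))"

definition quadratic_rep :: "('a::euclidean_space \<Rightarrow> 'a \<Rightarrow> 'a) \<Rightarrow> 'a \<Rightarrow> 'a \<Rightarrow> 'a" where
  "quadratic_rep jp a x = 2 *\<^sub>R jp a (jp a x) - jp (jp a a) x"

text \<open>A vector in \<open>\<real>\<^sup>n\<close> is a real list of length \<open>n\<close>.\<close>

definition decreasing_rearrangement :: "real list \<Rightarrow> real list" where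
  "decreasing_rearrangement p = rev (sort p)"

definition eigenvalue_vector :: "('a::euclidean_space \<Rightarrow> 'a \<Rightarrow> 'a) \<Rightarrow> 'a \<Rightarrow> 'a \<Rightarrow> real list" where
  "eigenvalue_vector jp e x = rev (sorted_list_of_multiset (eigenvalues jp e x))"

definition componentwise_product :: "real list \<Rightarrow> real list \<Rightarrow> real list" where
  "componentwise_product p q = map2 (*) p q"

definition weakly_majorized :: "nat \<Rightarrow> real list \<Rightarrow> real list \<Rightarrow> bool" where
  "weakly_majorized n p q \<longleftrightarrow>
     length p = n \<and> length q = n \<and>
     (\<forall>k\<in>{1..n}. sum_list (take k (decreasing_rearrangement p))
                 \<le> sum_list (take k (decreasing_rearrangement q)))"

text \<open>Log-majorization is a relation between vectors with nonnegative entries, so nonnegativity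
  of both vectors is part of it.\<close>

definition log_majorized :: "nat \<Rightarrow> real list \<Rightarrow> real list \<Rightarrow> bool" where
  "log_majorized n p q \<longleftrightarrow>
     length p = n \<and> length q = n \<and>
     (\<forall>t\<in>set p. 0 \<le> t) \<and> (\<forall>t\<in>set q. 0 \<le> t) \<and>
     (\<forall>k\<in>{1..n}. prod_list (take k (decreasing_rearrangement p))
                 \<le> prod_list (take k (decreasing_rearrangement q))) \<and>
     prod_list (take n (decreasing_rearrangement p)) =
       prod_list (take n (decreasing_rearrangement q))"

end

theory Submission
  imports Defs
begin

text \<open>For positive definite \<open>a\<close> and \<open>b\<close> consider the curve \<open>b(t) = P\<^bsub>a^(t/2)\<^esub> b\<close> from \<open>b\<close> to
  \<open>P\<^bsub>\<surd>a\<^esub> b\<close>. By the Peirce decomposition of a frame diagonalising \<open>a\<close> it solves the linear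
  equation \<open>b' = log a \<circ> b\<close>. If \<open>(e\<^sub>i)\<close> is a frame diagonalising \<open>b(t)\<close>, then to first order
  \<open>ln \<langle>e\<^sub>i, b(s)\<rangle> = ln \<lambda>\<^sub>i(b(t)) + (s - t) \<langle>e\<^sub>i, log a\<rangle>\<close>. Jensen's inequality and the doubly stochastic
  matrix \<open>\<langle>e\<^sub>i, f\<^sub>j\<rangle>\<close> of two frames bound the sum of the \<open>n - k\<close> smallest \<open>ln \<lambda>\<^sub>i(b(s))\<close> by the
  corresponding sum of \<open>ln \<langle>e\<^sub>i, b(s)\<rangle>\<close>, and the sum of the \<open>\<langle>e\<^sub>i, log a\<rangle>\<close> from below by that of
  the \<open>n - k\<close> smallest \<open>ln \<lambda>\<^sub>i(a)\<close>. Integrating over \<open>[0, 1]\<close> gives log-majorization in terms of the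
  smallest eigenvalues, with equality of the full products. Semidefinite \<open>a\<close>, \<open>b\<close> follow by continuity of
  the ordered eigenvalues.

  The spectral theorem comes from diagonalising multiplication by \<open>x\<close> on the span of the powers
  of \<open>x\<close>. That all frames have the same size, and hence that eigenvalues are well defined, is read
  off from the assumption that the inner product is the trace form.\<close>

section \<open>Real inequalities\<close>

text \<open>Discrete stand-in for integrating a differential inequality: \<open>Suc N\<close> equal
  steps accumulate the error \<open>C * T^2 / Suc N\<close>, which tends to 0. This suits sums of
  ordered eigenvalues, which need not be differentiable in \<open>t\<close>.\<close>

lemma le_of_quadratic_defect:
  fixes f :: "real \<Rightarrow> real"
  assumes defect: "\<And>s t. 0 \<le> s \<Longrightarrow> s \<le> t \<Longrightarrow> t \<le> T \<Longrightarrow> t - s \<le> \<delta> \<Longrightarrow>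
      f s \<le> f t + C * (t - s)\<^sup>2"
    and T: "0 \<le> T" and \<delta>: "0 < \<delta>"
  shows "f 0 \<le> f T"
proof -
  have bound: "f 0 \<le> f T + C * T\<^sup>2 / real (Suc N)" if "T / \<delta> \<le> real (Suc N)" for N
  proof -
    define h where "h = T / real (Suc N)"
    have h: "0 \<le> h" "real (Suc N) * h = T"
      using T by (auto simp: h_def)
    have "h \<le> \<delta>"
      using that \<delta> by (simp add: h_def field_simps del: of_nat_Suc)
    have "f 0 \<le> f (real j * h) + real j * (C * h\<^sup>2)" if "j \<le> Suc N" for j
      using that
    proof (induction j)
      case (Suc j)
      have "real (Suc j) * h \<le> T"
        using Suc.prems h by (metis mult_right_mono of_nat_le_iff)
      moreover have step: "real (Suc j) * h - real j * h = h"
        by (simp add: algebra_simps)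
      ultimately have "f (real j * h) \<le> f (real (Suc j) * h) + C * (real (Suc j) * h - real j * h)\<^sup>2"
        using h \<open>h \<le> \<delta>\<close> by (intro defect) (auto intro: mult_right_mono)
      then show ?case
        using Suc unfolding step by (simp add: algebra_simps)
    qed simp
    from this[of "Suc N"] have "f 0 \<le> f T + real (Suc N) * (C * h\<^sup>2)"
      using h by simp
    also have "real (Suc N) * (C * h\<^sup>2) = C * T\<^sup>2 / real (Suc N)"
      by (simp add: h_def power2_eq_square field_simps del: of_nat_Suc)
    finally show ?thesis .
  qed
  have "(\<lambda>N. f T + C * T\<^sup>2 / real (Suc N)) \<longlonglongrightarrow> f T + 0"
    by (intro tendsto_intros LIMSEQ_Suc[OF lim_const_over_n])
  moreover obtain N0 where "T / \<delta> \<le> real N0"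
    using real_arch_simple by blast
  then have "\<exists>N. \<forall>n\<ge>N. f 0 \<le> f T + C * T\<^sup>2 / real (Suc n)"
    using bound by (intro exI[of _ N0] allI impI) simp
  ultimately show ?thesis
    using LIMSEQ_le_const by fastforce
qed

text \<open>Subtract the threshold \<open>p = u (k - 1)\<close>: the terms with \<open>j < k\<close>
  become nonnegative and grow when the weight is raised to 1, the others become nonpositive and grow
  when it is lowered to 0. The shift costs \<open>k * p\<close> on both sides because the total
  weight is \<open>k\<close>.\<close>

lemma weighted_sum_le_top_sum:
  fixes w u :: "nat \<Rightarrow> real"
  assumes w: "\<And>j. j < n \<Longrightarrow> 0 \<le> w j" "\<And>j. j < n \<Longrightarrow> w j \<le> 1"
    and total: "(\<Sum>j<n. w j) = real k"
    and k: "k \<le> n"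
    and dec: "\<And>i j. i \<le> j \<Longrightarrow> j < n \<Longrightarrow> u j \<le> u i"
  shows "(\<Sum>j<n. w j * u j) \<le> (\<Sum>j<k. u j)"
proof (cases "k = 0")
  case True
  then have "w j = 0" if "j < n" for j
    using total w(1) that True sum_nonneg_eq_0_iff[of "{..<n}" w] by simp
  then show ?thesis
    using True by simp
next
  case False
  define p where "p = u (k - 1)"
  have "(\<Sum>j<n. w j * (u j - p)) \<le> (\<Sum>j<n. if j < k then u j - p else 0)"
  proof (rule sum_mono)
    fix j assume "j \<in> {..<n}"
    then have j: "j < n" by simp
    show "w j * (u j - p) \<le> (if j < k then u j - p else 0)"
    proof (cases "j < k")
      case True
      then have "p \<le> u j"
        unfolding p_def using k by (intro dec) auto
      then show ?thesis
        using mult_left_le_one_le[of "u j - p" "w j"] w[OF j] True by simp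
    next
      case False
      then have "u j \<le> p"
        unfolding p_def using j \<open>k \<noteq> 0\<close> by (intro dec) auto
      then show ?thesis
        using w[OF j] False by (simp add: mult_nonneg_nonpos)
    qed
  qed
  also have "\<dots> = (\<Sum>j<k. u j - p)"
  proof -
    have "{..<n} \<inter> {j. j < k} = {..<k}"
      using k by auto
    then show ?thesis
      by (simp add: sum.If_cases)
  qed
  also have "\<dots> = (\<Sum>j<k. u j) - real k * p"
    by (simp add: sum_subtractf)
  finally have "(\<Sum>j<n. w j * (u j - p)) \<le> (\<Sum>j<k. u j) - real k * p" .
  moreover have "(\<Sum>j<n. w j * (u j - p)) = (\<Sum>j<n. w j * u j) - real k * p"
    unfolding total[symmetric] sum_distrib_right by (simp add: right_diff_distrib sum_subtractf)
  ultimately show ?thesis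
    by simp
qed

text \<open>With \<open>d = ln q - ln p\<close>, the bound \<open>ln x <= x - 1\<close> gives
  \<open>p i * d i <= q i - p i\<close>. The product hypotheses make all partial sums of
  \<open>d\<close> nonnegative, and Abel summation against the decreasing weights \<open>p\<close>
  keeps the total nonnegative.\<close>

lemma sum_le_sum_of_prod_le_prod_pos:
  fixes p q :: "nat \<Rightarrow> real"
  assumes p: "\<And>i. i < k \<Longrightarrow> 0 < p i"
    and q: "\<And>i. i < k \<Longrightarrow> 0 < q i"
    and dec: "\<And>i j. i \<le> j \<Longrightarrow> j < k \<Longrightarrow> p j \<le> p i"
    and prods: "\<And>j. j \<le> k \<Longrightarrow> (\<Prod>i<j. p i) \<le> (\<Prod>i<j. q i)"
  shows "(\<Sum>i<k. p i) \<le> (\<Sum>i<k. q i)"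
proof -
  define d where "d i = ln (q i) - ln (p i)" for i
  have partial: "0 \<le> (\<Sum>i<j. d i)" if "j \<le> k" for j
  proof -
    have "ln (\<Prod>i<j. p i) \<le> ln (\<Prod>i<j. q i)"
      using that p q prods by (subst ln_le_cancel_iff) (auto intro!: prod_pos)
    moreover have "ln (\<Prod>i<j. p i) = (\<Sum>i<j. ln (p i))"
      using that p by (intro ln_prod) (auto simp: less_imp_neq[symmetric])
    moreover have "ln (\<Prod>i<j. q i) = (\<Sum>i<j. ln (q i))"
      using that q by (intro ln_prod) (auto simp: less_imp_neq[symmetric])
    ultimately show ?thesis
      by (simp add: d_def sum_subtractf)
  qed
  \<comment> \<open>Abel summation\<close>
  have abel: "p (j - 1) * (\<Sum>i<j. d i) \<le> (\<Sum>i<j. p i * d i)" if "j \<le> k" for j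
    using that
  proof (induction j)
    case (Suc j)
    have "p j * (\<Sum>i<j. d i) \<le> p (j - 1) * (\<Sum>i<j. d i)"
      using Suc.prems by (intro mult_right_mono dec partial) auto
    moreover have "p (j - 1) * (\<Sum>i<j. d i) \<le> (\<Sum>i<j. p i * d i)"
      using Suc by simp
    ultimately show ?case
      by (simp add: distrib_left)
  qed simp
  have "0 \<le> (\<Sum>i<k. p i * d i)"
  proof (cases "k = 0")
    case False
    then have "0 \<le> p (k - 1) * (\<Sum>i<k. d i)"
      using p partial by (simp add: less_imp_le)
    then show ?thesis
      using abel[of k] by simp
  qed simp
  also have "(\<Sum>i<k. p i * d i) \<le> (\<Sum>i<k. q i - p i)"
  proof (rule sum_mono)
    fix i assume "i \<in> {..<k}"
    then have pos: "0 < p i" "0 < q i"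
      using p q by auto
    then have "d i \<le> q i / p i - 1"
      unfolding d_def using ln_le_minus_one[of "q i / p i"] by (simp add: ln_div)
    then show "p i * d i \<le> q i - p i"
      using pos by (simp add: field_simps)
  qed
  finally show ?thesis
    by (simp add: sum_subtractf)
qed

text \<open>If the last \<open>p\<close> is zero, it contributes nothing and the induction
  hypothesis suffices. Otherwise all \<open>p\<close> are positive by monotonicity, the full product
  bound forces all \<open>q\<close> to be positive, and logarithms are available.\<close>

lemma sum_le_sum_of_prod_le_prod:
  fixes p q :: "nat \<Rightarrow> real"
  assumes p: "\<And>i. i < k \<Longrightarrow> 0 \<le> p i"
    and q: "\<And>i. i < k \<Longrightarrow> 0 \<le> q i"
    and dec: "\<And>i j. i \<le> j \<Longrightarrow> j < k \<Longrightarrow> p j \<le> p i"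
    and prods: "\<And>j. j \<le> k \<Longrightarrow> (\<Prod>i<j. p i) \<le> (\<Prod>i<j. q i)"
  shows "(\<Sum>i<k. p i) \<le> (\<Sum>i<k. q i)"
  using assms
proof (induction k)
  case (Suc k)
  show ?case
  proof (cases "p k = 0")
    case True
    have "(\<Sum>i<k. p i) \<le> (\<Sum>i<k. q i)"
      using Suc by auto
    then show ?thesis
      using True Suc.prems(2)[of k] by simp
  next
    case False
    then have "0 < p k"
      using Suc.prems(1)[of k] by simp
    have pos: "0 < p i" if "i < Suc k" for i
      using Suc.prems(3)[of i k] that \<open>0 < p k\<close> by simp
    have "0 < (\<Prod>i<Suc k. p i)"
      using pos by (intro prod_pos) auto
    then have "(\<Prod>i<Suc k. q i) \<noteq> 0"
      using Suc.prems(4)[of "Suc k"] by linarith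
    then have "q i \<noteq> 0" if "i < Suc k" for i
      using that by (metis finite_lessThan lessThan_iff prod_zero_iff)
    then have "0 < q i" if "i < Suc k" for i
      using Suc.prems(2)[of i] that by (simp add: order_less_le)
    then show ?thesis
      using pos Suc.prems by (intro sum_le_sum_of_prod_le_prod_pos) auto
  qed
qed simp

lemma sum_tail:
  fixes f :: "nat \<Rightarrow> real"
  shows "k \<le> n \<Longrightarrow> (\<Sum>i=k..<n. f i) = (\<Sum>i<n. f i) - (\<Sum>i<k. f i)"
  using sum.atLeastLessThan_concat[of 0 k n f] by (simp add: atLeast0LessThan)

text \<open>After factoring out \<open>exp (t * m)\<close> this is the Lagrange remainder of
  \<open>exp z\<close> at \<open>z = (s - t) * m\<close>. Since |z| <= |m| on the unit interval, one
  constant serves all \<open>s\<close> and \<open>t\<close>.\<close>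

lemma exp_second_order:
  fixes m :: real
  shows "\<exists>C\<ge>0. \<forall>s t. 0 \<le> s \<longrightarrow> s \<le> 1 \<longrightarrow> 0 \<le> t \<longrightarrow> t \<le> 1 \<longrightarrow>
    \<bar>exp (s * m) - exp (t * m) - (s - t) * (m * exp (t * m))\<bar> \<le> C * (s - t)\<^sup>2"
proof (intro exI[of _ "exp \<bar>m\<bar> * (exp \<bar>m\<bar> * m\<^sup>2)"] conjI allI impI)
  fix s t :: real
  assume st: "0 \<le> s" "s \<le> 1" "0 \<le> t" "t \<le> 1"
  define z where "z = (s - t) * m"
  have "exp (s * m) = exp (t * m) * exp z"
    by (simp add: z_def algebra_simps flip: exp_add)
  then have "exp (s * m) - exp (t * m) - (s - t) * (m * exp (t * m)) = exp (t * m) * (exp z - 1 - z)"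
    by (simp add: z_def algebra_simps)
  then have "\<bar>exp (s * m) - exp (t * m) - (s - t) * (m * exp (t * m))\<bar> = exp (t * m) * \<bar>exp z - 1 - z\<bar>"
    by (simp add: abs_mult)
  also have "\<dots> \<le> exp \<bar>m\<bar> * (exp \<bar>m\<bar> * m\<^sup>2 * (s - t)\<^sup>2)"
  proof (rule mult_mono)
    have "t * m \<le> t * \<bar>m\<bar>"
      using st by (intro mult_left_mono) auto
    also have "\<dots> \<le> \<bar>m\<bar>"
      using st by (intro mult_left_le_one_le) auto
    finally show "exp (t * m) \<le> exp \<bar>m\<bar>"
      by simp
    obtain x where x: "\<bar>x\<bar> \<le> \<bar>z\<bar>" "exp z = (\<Sum>i<2. z ^ i / fact i) + exp x / fact 2 * z ^ 2"
      using Maclaurin_exp_le by blast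
    have "\<bar>z\<bar> \<le> \<bar>m\<bar>"
      unfolding z_def abs_mult using st by (intro mult_left_le_one_le) auto
    then have "exp x \<le> exp \<bar>m\<bar>"
      using x(1) by simp
    then have "exp x / 2 \<le> exp \<bar>m\<bar>"
      using exp_ge_zero[of x] by linarith
    have "\<bar>exp z - 1 - z\<bar> = exp x / 2 * z\<^sup>2"
      unfolding x(2) by (simp add: numeral_2_eq_2 abs_mult)
    also have "\<dots> \<le> exp \<bar>m\<bar> * z\<^sup>2"
      using \<open>exp x / 2 \<le> exp \<bar>m\<bar>\<close> by (intro mult_right_mono) auto
    finally show "\<bar>exp z - 1 - z\<bar> \<le> exp \<bar>m\<bar> * m\<^sup>2 * (s - t)\<^sup>2"
      by (simp add: z_def power_mult_distrib mult_ac)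
  qed auto
  finally show "\<bar>exp (s * m) - exp (t * m) - (s - t) * (m * exp (t * m))\<bar>
      \<le> exp \<bar>m\<bar> * (exp \<bar>m\<bar> * m\<^sup>2) * (s - t)\<^sup>2"
    by (simp add: mult_ac)
qed simp

section \<open>Self-adjoint operators\<close>

text \<open>A maximiser \<open>u\<close> of the quadratic form on the compact unit sphere of
  \<open>S\<close> is an eigenvector: the first variation in every direction of \<open>S\<close>
  vanishes, so \<open>m *\<^sub>R u - L u\<close>, itself in \<open>S\<close>, is orthogonal to
  \<open>S\<close>.\<close>

lemma selfadjoint_eigenvector_exists:
  fixes L :: "'a::euclidean_space \<Rightarrow> 'a"
  assumes lin: "linear L" and selfadj: "\<And>x y. inner (L x) y = inner x (L y)"
    and S: "subspace S" "S \<noteq> {0}" and inv: "\<And>x. x \<in> S \<Longrightarrow> L x \<in> S"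
  shows "\<exists>u m. u \<in> S \<and> norm u = 1 \<and> L u = m *\<^sub>R u"
proof -
  define K where "K = S \<inter> sphere 0 1"
  have "compact K"
    unfolding K_def by (simp add: S(1) closed_Int_compact closed_subspace)
  obtain x where x: "x \<in> S" "x \<noteq> 0"
    using S subspace_0 by blast
  then have "(1 / norm x) *\<^sub>R x \<in> K"
    using S(1) by (auto simp: K_def subspace_scale)
  moreover have "continuous_on K (\<lambda>v. inner (L v) v)"
    using lin by (intro continuous_on_inner linear_continuous_on continuous_on_id)
      (simp add: linear_conv_bounded_linear)
  ultimately obtain u where u: "u \<in> K" and max: "\<And>v. v \<in> K \<Longrightarrow> inner (L v) v \<le> inner (L u) u"
    using continuous_attains_sup[OF \<open>compact K\<close>, of "\<lambda>v. inner (L v) v"] by blast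
  define m where "m = inner (L u) u"
  have uS: "u \<in> S" and nu: "norm u = 1"
    using u by (auto simp: K_def)
  have form: "inner (L v) v \<le> m * (norm v)\<^sup>2" if "v \<in> S" for v
  proof (cases "v = 0")
    case False
    then have "(1 / norm v) *\<^sub>R v \<in> K"
      using S(1) that by (auto simp: K_def subspace_scale)
    then have "inner (L ((1 / norm v) *\<^sub>R v)) ((1 / norm v) *\<^sub>R v) \<le> m"
      unfolding m_def by (rule max)
    then show ?thesis
      using False by (simp add: linear_scale[OF lin] field_simps power2_eq_square)
  qed (simp add: linear_0[OF lin])
  have "inner (m *\<^sub>R u - L u) w = 0" if w: "w \<in> S" for w
  proof (rule ccontr)
    define B where "B = inner (m *\<^sub>R u - L u) w"
    define Q where "Q = m * (norm w)\<^sup>2 - inner (L w) w"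
    assume "inner (m *\<^sub>R u - L u) w \<noteq> 0"
    then have "B \<noteq> 0" by (simp add: B_def)
    have quad: "0 \<le> 2 * t * B + t\<^sup>2 * Q" for t
    proof -
      have "u + t *\<^sub>R w \<in> S"
        using S(1) uS w by (simp add: subspace_add subspace_scale)
      from form[OF this] have "inner (L (u + t *\<^sub>R w)) (u + t *\<^sub>R w) \<le> m * (norm (u + t *\<^sub>R w))\<^sup>2" .
      moreover have "inner (L (u + t *\<^sub>R w)) (u + t *\<^sub>R w) = m + 2 * t * inner (L u) w + t\<^sup>2 * inner (L w) w"
        using selfadj[of w u]
        by (simp add: linear_add[OF lin] linear_scale[OF lin] inner_add_left inner_add_right
            m_def inner_commute algebra_simps power2_eq_square)
      moreover have "(norm (u + t *\<^sub>R w))\<^sup>2 = 1 + 2 * t * inner u w + t\<^sup>2 * (norm w)\<^sup>2"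
        unfolding power2_norm_eq_inner using nu
        by (simp add: inner_add_left inner_add_right norm_eq_1 inner_commute[of w u]
            power2_eq_square algebra_simps)
      ultimately show ?thesis
        by (simp add: B_def Q_def inner_diff_left algebra_simps)
    qed
    \<comment> \<open>The choice gives \<open>t * (\<bar>Q\<bar> + 1) = - B\<close>, so the
      quadratic term is at most \<open>- t * B\<close> and \<open>quad\<close> would force
      \<open>0 <= t * B\<close>, although \<open>t * B\<close> is negative.\<close>
    define t where "t = - B / (\<bar>Q\<bar> + 1)"
    have "t\<^sup>2 * Q \<le> t\<^sup>2 * (\<bar>Q\<bar> + 1)"
      by (intro mult_left_mono) auto
    also have "\<dots> = - t * B"
    proof -
      have "t * (\<bar>Q\<bar> + 1) = - B"
        by (simp add: t_def)
      then show ?thesis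
        by (simp add: power2_eq_square mult.assoc)
    qed
    finally have "0 \<le> t * B"
      using quad[of t] by simp
    moreover have "t * B = - (B\<^sup>2 / (\<bar>Q\<bar> + 1))"
      by (simp add: t_def power2_eq_square)
    moreover have "0 < B\<^sup>2 / (\<bar>Q\<bar> + 1)"
      using \<open>B \<noteq> 0\<close> by (intro divide_pos_pos) auto
    ultimately show False by linarith
  qed
  moreover have "m *\<^sub>R u - L u \<in> S"
    using S(1) uS inv by (simp add: subspace_diff subspace_scale)
  ultimately have "m *\<^sub>R u - L u = 0"
    using inner_eq_zero_iff by blast
  then show ?thesis
    using uS nu by (intro exI[of _ u] exI[of _ m]) simp
qed

text \<open>Induction on the dimension: split off one unit eigenvector and continue in its
  orthogonal complement within \<open>S\<close>, which \<open>L\<close> preserves by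
  self-adjointness. Indexing by eigenvalues gives each eigenvalue a single component.\<close>

lemma selfadjoint_eigendecomposition:
  fixes L :: "'a::euclidean_space \<Rightarrow> 'a"
  assumes lin: "linear L" and selfadj: "\<And>x y. inner (L x) y = inner x (L y)"
    and "subspace S" and "\<And>x. x \<in> S \<Longrightarrow> L x \<in> S" and "v \<in> S"
  shows "\<exists>M w. finite M \<and> (\<forall>m\<in>M. w m \<in> S \<and> L (w m) = m *\<^sub>R w m) \<and> v = (\<Sum>m\<in>M. w m)"
  using assms(3-)
proof (induction "dim S" arbitrary: S v rule: less_induct)
  case less
  show ?case
  proof (cases "S = {0}")
    case True
    then show ?thesis
      using less.prems by (intro exI[of _ "{}"]) auto
  next
    case False
    obtain u l where u: "u \<in> S" "norm u = 1" "L u = l *\<^sub>R u"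
      using selfadjoint_eigenvector_exists[OF lin selfadj less.prems(1) False less.prems(2)] by blast
    define S' where "S' = {x \<in> S. inner u x = 0}"
    have S': "subspace S'"
      using less.prems(1) unfolding S'_def subspace_def by (auto simp: inner_add_right)
    have "inner u u = 1"
      using u(2) by (simp add: norm_eq_1)
    then have "u \<in> S - S'"
      using u(1) by (simp add: S'_def del: inner_eq_zero_iff)
    then have "S' \<subset> S"
      unfolding S'_def by blast
    then have dim: "dim S' < dim S"
      using S' less.prems(1) by (intro dim_psubset) (simp add: span_eq_iff[THEN iffD2])
    have inv': "L x \<in> S'" if "x \<in> S'" for x
      using that less.prems(2) selfadj[of u x] u by (auto simp: S'_def)
    have rest: "v - inner u v *\<^sub>R u \<in> S'"
      using less.prems u by (auto simp: S'_def subspace_diff subspace_scale inner_diff_right norm_eq_1)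
    obtain M w where M: "finite M" "\<forall>m\<in>M. w m \<in> S' \<and> L (w m) = m *\<^sub>R w m"
        "v - inner u v *\<^sub>R u = (\<Sum>m\<in>M. w m)"
      using less.hyps[OF dim S' _ rest] inv' by blast
    \<comment> \<open>The eigenvalue \<open>l\<close> may already occur in \<open>M\<close>, so the
      new component is added to the old one; values of \<open>w\<close> outside \<open>M\<close> are
      unspecified and replaced by 0.\<close>
    define w' where "w' m = (if m \<in> M then w m else 0) + (if m = l then inner u v *\<^sub>R u else 0)" for m
    have eig: "w' m \<in> S \<and> L (w' m) = m *\<^sub>R w' m" for m
    proof -
      have "(if m \<in> M then w m else 0) \<in> S" "(if m = l then inner u v *\<^sub>R u else 0) \<in> S"
        using M(2) u(1) less.prems(1) by (auto simp: S'_def subspace_scale subspace_0)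
      moreover have "L (if m \<in> M then w m else 0) = m *\<^sub>R (if m \<in> M then w m else 0)"
        using M(2) by (simp add: linear_0[OF lin])
      moreover have "L (if m = l then inner u v *\<^sub>R u else 0) = m *\<^sub>R (if m = l then inner u v *\<^sub>R u else 0)"
        using u(3) by (simp add: linear_0[OF lin] linear_scale[OF lin])
      ultimately show ?thesis
        unfolding w'_def using less.prems(1)
        by (simp only: subspace_add linear_add[OF lin] scaleR_add_right)
    qed
    have "v = (\<Sum>m\<in>insert l M. w' m)"
    proof -
      have "(\<Sum>m\<in>insert l M. w' m) = (\<Sum>m\<in>insert l M. if m \<in> M then w m else 0) + inner u v *\<^sub>R u"
        using M(1) by (simp add: w'_def sum.distrib)
      also have "(\<Sum>m\<in>insert l M. if m \<in> M then w m else 0) = (\<Sum>m\<in>M. w m)"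
        using M(1) by (intro sum.mono_neutral_cong_right) auto
      finally show ?thesis
        using M(3) by (simp add: algebra_simps)
    qed
    then show ?thesis
      using M(1) eig by (intro exI[of _ "insert l M"] exI[of _ w'] conjI ballI) simp_all
  qed
qed

section \<open>Spectral decomposition\<close>

context euclidean_jordan_algebra
begin

section \<open>Bilinear calculus and the linearized Jordan identity\<close>

lemma linear_left: "linear (\<lambda>x. x \<odot> y)" and linear_right: "linear (\<lambda>y. x \<odot> y)"
  using bilinear by (auto simp: bilinear_def)

lemma jp_simps [simp]:
  "0 \<odot> x = 0" "x \<odot> 0 = 0" "e \<odot> x = x" "x \<odot> e = x"
  "(t *\<^sub>R x) \<odot> y = t *\<^sub>R (x \<odot> y)" "x \<odot> (t *\<^sub>R y) = t *\<^sub>R (x \<odot> y)"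
  "(- x) \<odot> y = - (x \<odot> y)" "x \<odot> (- y) = - (x \<odot> y)"
  using unit commute[of x e]
  by (simp_all add: bilinear_lzero[OF bilinear] bilinear_rzero[OF bilinear]
      bilinear_lmul[OF bilinear] bilinear_rmul[OF bilinear]
      bilinear_lneg[OF bilinear] bilinear_rneg[OF bilinear])

lemma jp_distrib:
  "(x + y) \<odot> z = x \<odot> z + y \<odot> z" "x \<odot> (y + z) = x \<odot> y + x \<odot> z"
  "(x - y) \<odot> z = x \<odot> z - y \<odot> z" "x \<odot> (y - z) = x \<odot> y - x \<odot> z"
  by (simp_all add: bilinear_ladd[OF bilinear] bilinear_radd[OF bilinear]
      bilinear_lsub[OF bilinear] bilinear_rsub[OF bilinear])

lemma jp_sum_left: "(\<Sum>i\<in>I. f i) \<odot> y = (\<Sum>i\<in>I. f i \<odot> y)"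
  using linear_sum[OF linear_left, of f I y] by simp

lemma jp_sum_right: "y \<odot> (\<Sum>i\<in>I. f i) = (\<Sum>i\<in>I. y \<odot> f i)"
  using linear_sum[OF linear_right, of y f I] by simp

lemma inner_jp_swap: "inner (x \<odot> y) z = inner x (y \<odot> z)"
  using inner_assoc[of y x z] by (simp add: commute)

lemma unit_nonzero: "e \<noteq> 0"
proof
  assume "e = 0"
  then have "x = 0" for x :: 'a
    using unit[of x] by simp
  then show False
    using nonempty_Basis nonzero_Basis by blast
qed

text \<open>Full polarisation of the Jordan identity. The defect \<open>D\<close> is trilinear,
  symmetric in its last two arguments and zero on the diagonal; adding its values at
  \<open>p + q\<close> and \<open>q - p\<close> isolates the part quadratic in \<open>p\<close>, and
  substituting \<open>y + z\<close> there isolates the trilinear part.\<close>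

lemma jordan_linearized:
  "x \<odot> ((y \<odot> z) \<odot> u) + y \<odot> ((z \<odot> x) \<odot> u) + z \<odot> ((x \<odot> y) \<odot> u)
    = (y \<odot> z) \<odot> (x \<odot> u) + (z \<odot> x) \<odot> (y \<odot> u) + (x \<odot> y) \<odot> (z \<odot> u)"
proof -
  define D where "D p q r = p \<odot> ((q \<odot> r) \<odot> u) - (q \<odot> r) \<odot> (p \<odot> u)" for p q r
  have sym: "D p q r = D p r q" for p q r
    by (simp add: D_def commute[of q r])
  have add: "D (p + p') q r = D p q r + D p' q r" "D p (q + q') r = D p q r + D p q' r"
    "D p q (r + r') = D p q r + D p q r'" for p p' q q' r r'
    by (simp_all add: D_def jp_distrib)
  have cube: "D p p p = 0" for p
    by (simp add: D_def jordan)
  have neg: "D (- p) q r = - D p q r" "D p (- q) r = - D p q r" "D p q (- r) = - D p q r" for p q r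
    by (simp_all add: D_def)
  have quad: "D q p p + 2 *\<^sub>R D p p q = 0" for p q
  proof -
    have "D (p + q) (p + q) (p + q) + D (q + - p) (q + - p) (q + - p) = 2 *\<^sub>R (D q p p + 2 *\<^sub>R D p p q) + 2 *\<^sub>R D q q q"
      unfolding add neg using sym[of p q p] sym[of q p q]
      by (simp add: scaleR_2)
    then show ?thesis
      by (simp add: cube)
  qed
  have "D x (y + z) (y + z) + 2 *\<^sub>R D (y + z) (y + z) x - (D x y y + 2 *\<^sub>R D y y x)
      - (D x z z + 2 *\<^sub>R D z z x) = 2 *\<^sub>R (D x y z + D y z x + D z x y)"
    unfolding add using sym[of x z y] sym[of z y x] by (simp add: scaleR_2)
  then have "D x y z + D y z x + D z x y = 0"
    by (simp add: quad)
  then show ?thesis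
    by (simp add: D_def algebra_simps)
qed

text \<open>The linearized identity read as an operator identity in \<open>w\<close>: multiplication
  by a threefold product is expressed through multiplications by its factors and their pairwise
  products.\<close>

lemma jp_triple:
  "((x \<odot> y) \<odot> u) \<odot> w
    = (x \<odot> u) \<odot> (y \<odot> w) + (y \<odot> u) \<odot> (x \<odot> w) + (x \<odot> y) \<odot> (u \<odot> w)
      - x \<odot> (u \<odot> (y \<odot> w)) - y \<odot> (u \<odot> (x \<odot> w))"
proof -
  have "x \<odot> ((y \<odot> w) \<odot> u) + y \<odot> ((w \<odot> x) \<odot> u) + w \<odot> ((x \<odot> y) \<odot> u)
    = (y \<odot> w) \<odot> (x \<odot> u) + (w \<odot> x) \<odot> (y \<odot> u) + (x \<odot> y) \<odot> (w \<odot> u)"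
    by (rule jordan_linearized)
  moreover have "x \<odot> ((y \<odot> w) \<odot> u) = x \<odot> (u \<odot> (y \<odot> w))"
    "y \<odot> ((w \<odot> x) \<odot> u) = y \<odot> (u \<odot> (x \<odot> w))"
    "w \<odot> ((x \<odot> y) \<odot> u) = ((x \<odot> y) \<odot> u) \<odot> w"
    "(y \<odot> w) \<odot> (x \<odot> u) = (x \<odot> u) \<odot> (y \<odot> w)"
    "(w \<odot> x) \<odot> (y \<odot> u) = (y \<odot> u) \<odot> (x \<odot> w)"
    "(x \<odot> y) \<odot> (w \<odot> u) = (x \<odot> y) \<odot> (u \<odot> w)"
    by (simp_all only: commute)
  ultimately show ?thesis
    by (simp add: algebra_simps)
qed

section \<open>Powers of an element\<close>

primrec jpow :: "'a \<Rightarrow> nat \<Rightarrow> 'a" where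
  "jpow x 0 = e"
| "jpow x (Suc k) = x \<odot> jpow x k"

text \<open>\<open>jp_triple\<close> expresses multiplication by a power through multiplications by
  the two preceding powers, by \<open>x\<close> and by \<open>x \<odot> x\<close>. All of these
  commute with multiplication by \<open>x\<close>, the last one by the Jordan axiom.\<close>

lemma jpow_operator_commute: "jpow x k \<odot> (x \<odot> w) = x \<odot> (jpow x k \<odot> w)"
proof (induction k arbitrary: w rule: less_induct)
  case (less k)
  consider "k = 0" | "k = 1" | j where "k = Suc (Suc j)"
    by (metis One_nat_def nat.exhaust)
  then show ?case
  proof cases
    case (3 j)
    define p where "p = jpow x j"
    define q where "q = jpow x (Suc j)"
    have expand: "jpow x k \<odot> v = (x \<odot> x) \<odot> (p \<odot> v) + 2 *\<^sub>R (q \<odot> (x \<odot> v))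
        - x \<odot> (x \<odot> (p \<odot> v)) - p \<odot> (x \<odot> (x \<odot> v))" for v
      using jp_triple[of x p x v] 3
      by (simp add: p_def q_def commute scaleR_2)
    have p: "p \<odot> (x \<odot> v) = x \<odot> (p \<odot> v)" and q: "q \<odot> (x \<odot> v) = x \<odot> (q \<odot> v)" for v
      unfolding p_def q_def using less[of j] less[of "Suc j"] 3 by simp_all
    show ?thesis
      unfolding expand by (simp add: p q jp_distrib jordan)
  qed simp_all
qed

definition power_span :: "'a \<Rightarrow> 'a set" where
  "power_span x = span (range (jpow x))"

lemma subspace_power_span: "subspace (power_span x)"
  by (simp add: power_span_def)

lemma power_span_operator_commute:
  assumes "p \<in> power_span x"
  shows "p \<odot> (x \<odot> w) = x \<odot> (p \<odot> w)"
  using assms unfolding power_span_def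
  by (induction rule: span_induct_alt) (auto simp: jp_distrib jpow_operator_commute)

lemma power_span_closed:
  assumes "p \<in> power_span x"
  shows "x \<odot> p \<in> power_span x"
  using assms unfolding power_span_def
proof (induction rule: span_induct_alt)
  case (step c y z)
  then obtain k where "y = jpow x k" by blast
  then have "x \<odot> y = jpow x (Suc k)" by simp
  then have "x \<odot> y \<in> span (range (jpow x))"
    by (metis rangeI span_base)
  then show ?case
    using step by (simp add: jp_distrib span_add span_scale)
qed (simp add: span_zero)

section \<open>Complete systems of orthogonal idempotents\<close>

text \<open>A Jordan frame with primitivity weakened to being nonzero. Uniqueness of spectral data
  already holds at this level, and a system of maximal size turns out to be a frame.\<close>

definition idempotent_system :: "'a set \<Rightarrow> bool" where
  "idempotent_system F \<longleftrightarrow> finite F \<and> (\<forall>c\<in>F. c \<odot> c = c \<and> c \<noteq> 0) \<and>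
     (\<forall>c\<in>F. \<forall>d\<in>F. c \<noteq> d \<longrightarrow> c \<odot> d = 0) \<and> \<Sum>F = e"

lemma orthogonal_idempotents_inner:
  assumes "c \<odot> c = c" "c \<odot> d = 0"
  shows "inner c d = 0"
  using inner_jp_swap[of c c d] assms by simp

lemma idempotent_inner_unit: "c \<odot> c = c \<Longrightarrow> inner c e = inner c c"
  by (metis inner_jp_swap jp_simps(4))

text \<open>The members are nonzero and pairwise orthogonal, hence linearly independent. The bound
  makes refinement of systems terminate.\<close>

lemma idempotent_system_card: "idempotent_system F \<Longrightarrow> card F \<le> DIM('a)"
proof -
  assume F: "idempotent_system F"
  have "pairwise orthogonal F"
    using F unfolding pairwise_def orthogonal_def idempotent_system_def
    by (metis orthogonal_idempotents_inner)
  then have "independent F"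
    using F by (intro pairwise_orthogonal_independent) (auto simp: idempotent_system_def)
  then show ?thesis
    by (simp add: independent_bound)
qed

text \<open>Decompose \<open>e\<close> within the span of the powers of \<open>x\<close> into
  eigenvectors of multiplication by \<open>x\<close>. Since elements of this span operator-commute
  with \<open>x\<close>, the product of two components is scaled by either eigenvalue, so it
  vanishes when these differ. Multiplying the decomposition of \<open>e\<close> by one component
  shows it to be idempotent; multiplying it by \<open>x\<close> gives the expansion of
  \<open>x\<close>.\<close>

lemma spectral_idempotents_exist:
  "\<exists>F r. idempotent_system F \<and> x = (\<Sum>c\<in>F. r c *\<^sub>R c)"
proof -
  have lin: "linear (\<lambda>y. x \<odot> y)"
    by (rule linear_right)
  have sa: "inner (x \<odot> y) z = inner y (x \<odot> z)" for y z
    by (rule inner_assoc)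
  have "e \<in> power_span x"
    unfolding power_span_def by (metis jpow.simps(1) rangeI span_base)
  then obtain M w where M: "finite M" "\<forall>m\<in>M. w m \<in> power_span x \<and> x \<odot> w m = m *\<^sub>R w m"
      and sum_e: "e = (\<Sum>m\<in>M. w m)"
    using selfadjoint_eigendecomposition[where L = "\<lambda>y. x \<odot> y" and S = "power_span x" and v = e,
        OF lin sa subspace_power_span power_span_closed] by metis
  have orth: "w m \<odot> w l = 0" if "m \<in> M" "l \<in> M" "m \<noteq> l" for m l
  proof -
    have "l *\<^sub>R (w m \<odot> w l) = w m \<odot> (x \<odot> w l)"
      using M(2) that by simp
    also have "\<dots> = x \<odot> (w m \<odot> w l)"
      using M(2) that by (intro power_span_operator_commute) auto
    also have "\<dots> = x \<odot> (w l \<odot> w m)"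
      by (simp add: commute)
    also have "\<dots> = w l \<odot> (x \<odot> w m)"
      using M(2) that by (intro power_span_operator_commute[symmetric]) auto
    also have "\<dots> = m *\<^sub>R (w m \<odot> w l)"
      using M(2) that by (simp add: commute)
    finally have "l = m \<or> w m \<odot> w l = 0"
      by (simp only: scaleR_cancel_right)
    then show ?thesis
      using that by blast
  qed
  have idem: "w m \<odot> w m = w m" if "m \<in> M" for m
  proof -
    have "w m = w m \<odot> (\<Sum>l\<in>M. w l)"
      unfolding sum_e[symmetric] by simp
    also have "\<dots> = (\<Sum>l\<in>M. if l = m then w m \<odot> w m else 0)"
      unfolding jp_sum_right using orth that by (intro sum.cong) auto
    finally show ?thesis
      using that M(1) by simp
  qed
  \<comment> \<open>Zero components are dropped, since they violate \<open>idempotent_system\<close>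
    and could spoil the injectivity of \<open>w\<close>, through which a coefficient is recovered
    from its idempotent.\<close>
  define M' where "M' = {m \<in> M. w m \<noteq> 0}"
  have inj: "inj_on w M'"
  proof (rule inj_onI)
    fix m l assume "m \<in> M'" "l \<in> M'" "w m = w l"
    then show "m = l"
      using orth[of m l] idem[of m] by (auto simp: M'_def)
  qed
  have restrict: "(\<Sum>m\<in>M. g m *\<^sub>R w m) = (\<Sum>m\<in>M'. g m *\<^sub>R w m)" for g :: "real \<Rightarrow> real"
    using M(1) by (intro sum.mono_neutral_right) (auto simp: M'_def)
  have "idempotent_system (w ` M')"
    unfolding idempotent_system_def
  proof (intro conjI ballI impI)
    show "\<Sum>(w ` M') = e"
      using restrict[of "\<lambda>_. 1"] sum_e by (simp add: sum.reindex[OF inj])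
  qed (use M(1) idem orth in \<open>auto simp: M'_def\<close>)
  moreover have "x = (\<Sum>c\<in>w ` M'. the_inv_into M' w c *\<^sub>R c)"
  proof -
    have "x = x \<odot> (\<Sum>m\<in>M. w m)"
      unfolding sum_e[symmetric] by simp
    also have "\<dots> = (\<Sum>m\<in>M. m *\<^sub>R w m)"
      unfolding jp_sum_right using M(2) by (intro sum.cong) auto
    finally show ?thesis
      using restrict[of "\<lambda>m. m"] by (simp add: sum.reindex[OF inj] the_inv_into_f_f[OF inj])
  qed
  ultimately show ?thesis
    by (intro exI[of _ "w ` M'"] exI[of _ "the_inv_into M' w"] conjI)
qed

section \<open>Peirce rules and splitting of idempotents\<close>

text \<open>In the linearized identity at \<open>c\<close>, \<open>c\<close>, \<open>d\<close> every
  term containing \<open>c \<odot> d\<close> drops out and only the two sides of the claim remain.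
  Here \<open>d\<close> is any element of the Peirce 0-space of \<open>c\<close>.\<close>

lemma orthogonal_idempotent_commute:
  assumes "c \<odot> c = c" "c \<odot> d = 0"
  shows "c \<odot> (d \<odot> w) = d \<odot> (c \<odot> w)"
  using jordan_linearized[of c c d w] assms by (simp add: commute[of d c])

text \<open>The analogue for \<open>u\<close> in the Peirce 1-space of \<open>c\<close>: in the same
  identity the surviving terms cancel down to one on each side.\<close>

lemma sub_idempotent_commute:
  assumes "c \<odot> c = c" "c \<odot> u = u"
  shows "c \<odot> (u \<odot> w) = u \<odot> (c \<odot> w)"
  using jordan_linearized[of c c u w] assms by (simp add: commute[of u c] algebra_simps)

text \<open>The Peirce 1-space and 0-space of \<open>c\<close> multiply to zero: by the two
  commutation rules, multiplication by \<open>c\<close> sends \<open>u \<odot> d\<close> both to 0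
  and to itself.\<close>

lemma orthogonal_to_sub_idempotent:
  assumes "c \<odot> c = c" "c \<odot> u = u" "c \<odot> d = 0"
  shows "u \<odot> d = 0"
  using sub_idempotent_commute[OF assms(1,2), of d] orthogonal_idempotent_commute[OF assms(1,3), of u]
    assms by (simp add: commute)

lemma idempotent_summands_orthogonal:
  assumes "u \<odot> u = u" "v \<odot> v = v" "(u + v) \<odot> (u + v) = u + v"
  shows "u \<odot> v = 0"
  using assms by (simp add: jp_distrib commute[of v u] scaleR_2[symmetric] algebra_simps)

text \<open>Both parts of \<open>c\<close> lie in its Peirce 1-space and the other members in its
  0-space, so orthogonality survives the splitting. The three disequalities ensure that the system
  grows by exactly one member.\<close>

lemma refine_idempotent_system:
  assumes F: "idempotent_system F" and c: "c \<in> F"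
    and uv: "u \<odot> u = u" "v \<odot> v = v" "u \<noteq> 0" "v \<noteq> 0" "c = u + v"
  shows "idempotent_system (insert u (insert v (F - {c})))"
    and "u \<notin> F" and "v \<notin> F" and "u \<noteq> v"
proof -
  have "c \<odot> c = c"
    using F c by (auto simp: idempotent_system_def)
  then have "u \<odot> v = 0"
    using uv idempotent_summands_orthogonal by simp
  then have cu: "c \<odot> u = u" and cv: "c \<odot> v = v"
    unfolding uv(5) using uv(1,2) commute[of v u] by (simp_all add: jp_distrib)
  have orth: "u \<odot> d = 0" "v \<odot> d = 0" if "d \<in> F - {c}" for d
  proof -
    have "c \<odot> d = 0"
      using that F c by (auto simp: idempotent_system_def)
    then show "u \<odot> d = 0" "v \<odot> d = 0"
      using \<open>c \<odot> c = c\<close> cu cv by (auto intro: orthogonal_to_sub_idempotent)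
  qed
  show "u \<noteq> v"
    using \<open>u \<odot> v = 0\<close> uv by auto
  have "u \<noteq> c" "v \<noteq> c"
    using uv by auto
  show "u \<notin> F" "v \<notin> F"
    using orth \<open>u \<noteq> c\<close> \<open>v \<noteq> c\<close> uv by (metis Diff_iff empty_iff insert_iff)+
  have "\<Sum>(insert u (insert v (F - {c}))) = u + (v + \<Sum>(F - {c}))"
    using F \<open>u \<notin> F\<close> \<open>v \<notin> F\<close> \<open>u \<noteq> v\<close> by (auto simp: idempotent_system_def)
  also have "\<dots> = c + \<Sum>(F - {c})"
    using uv by (simp add: add.assoc)
  also have "\<dots> = e"
    using F c sum.remove[of F c "\<lambda>c. c"] by (simp add: idempotent_system_def)
  finally have sum: "\<Sum>(insert u (insert v (F - {c}))) = e" .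
  show "idempotent_system (insert u (insert v (F - {c})))"
    unfolding idempotent_system_def
  proof (intro conjI ballI impI)
    fix a b assume ab: "a \<in> insert u (insert v (F - {c}))" "b \<in> insert u (insert v (F - {c}))" "a \<noteq> b"
    have "a \<odot> b = 0 \<or> b \<odot> a = 0"
      using ab F orth \<open>u \<odot> v = 0\<close> by (auto simp: idempotent_system_def)
    then show "a \<odot> b = 0"
      using commute[of a b] by auto
  qed (use F uv sum in \<open>auto simp: idempotent_system_def\<close>)
qed

text \<open>Among the systems diagonalising \<open>x\<close> one of maximal size is a frame: a
  member that is not primitive could be split, both parts inheriting its coefficient, which yields a
  larger such system.\<close>

theorem spectral_decomposition_exists: "\<exists>F r. spectral_decomposition jp e x F r"
proof -
  define P where "P k \<longleftrightarrow> (\<exists>F r. idempotent_system F \<and> x = (\<Sum>c\<in>F. r c *\<^sub>R c) \<and> card F = k)" for k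
  have "\<exists>k. P k"
    unfolding P_def using spectral_idempotents_exist by blast
  moreover have "\<forall>k. P k \<longrightarrow> k \<le> DIM('a)"
    unfolding P_def using idempotent_system_card by blast
  ultimately obtain k where k: "P k" and max: "\<And>j. P j \<Longrightarrow> j \<le> k"
    using Nat.ex_has_greatest_nat[of P _ "DIM('a)"] by blast
  then obtain F r where F: "idempotent_system F" and x: "x = (\<Sum>c\<in>F. r c *\<^sub>R c)" and card: "card F = k"
    unfolding P_def by blast
  have fin: "finite F"
    using F by (simp add: idempotent_system_def)
  have "primitive_idempotent jp c" if c: "c \<in> F" for c
  proof (rule ccontr)
    assume "\<not> primitive_idempotent jp c"
    then obtain u v where uv: "u \<odot> u = u" "v \<odot> v = v" "u \<noteq> 0" "v \<noteq> 0" "c = u + v"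
      using F c by (auto simp: primitive_idempotent_def idempotent_def idempotent_system_def)
    note refined = refine_idempotent_system[OF F c uv]
    define r' where "r' = r(u := r c, v := r c)"
    have "card (insert u (insert v (F - {c}))) = Suc k"
      using refined(2-4) fin c card card_Suc_Diff1[OF fin c] by simp
    moreover have "x = (\<Sum>d\<in>insert u (insert v (F - {c})). r' d *\<^sub>R d)"
    proof -
      have "(\<Sum>d\<in>insert u (insert v (F - {c})). r' d *\<^sub>R d)
          = r c *\<^sub>R u + (r c *\<^sub>R v + (\<Sum>d\<in>F - {c}. r' d *\<^sub>R d))"
        using refined(2-4) fin by (simp add: r'_def)
      also have "(\<Sum>d\<in>F - {c}. r' d *\<^sub>R d) = (\<Sum>d\<in>F - {c}. r d *\<^sub>R d)"
        using refined(2,3) by (intro sum.cong) (auto simp: r'_def)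
      also have "r c *\<^sub>R u + (r c *\<^sub>R v + \<dots>) = r c *\<^sub>R c + \<dots>"
        using uv(5) by (simp add: scaleR_add_right add.assoc)
      also have "\<dots> = x"
        unfolding x by (rule sum.remove[OF fin c, symmetric])
      finally show ?thesis ..
    qed
    ultimately have "P (Suc k)"
      unfolding P_def using refined(1) by blast
    then show False
      using max[of "Suc k"] by simp
  qed
  then have "jordan_frame jp e F"
    using F by (simp add: jordan_frame_def idempotent_system_def)
  then show ?thesis
    using x unfolding spectral_decomposition_def by blast
qed

end

section \<open>Uniqueness of eigenvalues\<close>

context euclidean_jordan_algebra
begin

section \<open>Independence of the chosen decomposition\<close>

lemma jordan_frame_idempotent_system: "jordan_frame jp e F \<Longrightarrow> idempotent_system F"
  by (auto simp: jordan_frame_def idempotent_system_def primitive_idempotent_def idempotent_def)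

lemma idempotent_system_eigenvector:
  assumes F: "idempotent_system F" and d: "d \<in> F"
  shows "(\<Sum>c\<in>F. r c *\<^sub>R c) \<odot> d = r d *\<^sub>R d"
proof -
  have "(\<Sum>c\<in>F. r c *\<^sub>R c) \<odot> d = (\<Sum>c\<in>F. if c = d then r d *\<^sub>R d else 0)"
    unfolding jp_sum_left using F d by (intro sum.cong) (auto simp: idempotent_system_def)
  also have "\<dots> = r d *\<^sub>R d"
    using F d by (simp add: idempotent_system_def)
  finally show ?thesis .
qed

text \<open>The difference \<open>W m\<close> of the two spectral idempotents satisfies the
  eigenvector equation for \<open>x\<close> and \<open>m\<close>, so these differences are mutually
  orthogonal. They sum to \<open>e - e = 0\<close>, hence each is zero.\<close>

lemma spectral_idempotent_unique:
  assumes F: "idempotent_system F" and G: "idempotent_system G"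
    and eq: "(\<Sum>c\<in>F. r c *\<^sub>R c) = (\<Sum>d\<in>G. s d *\<^sub>R d)"
  shows "\<Sum>{c \<in> F. r c = m} = \<Sum>{d \<in> G. s d = m}"
proof -
  define x where "x = (\<Sum>c\<in>F. r c *\<^sub>R c)"
  define W where "W m = \<Sum>{c \<in> F. r c = m} - \<Sum>{d \<in> G. s d = m}" for m
  define M where "M = r ` F \<union> s ` G"
  have fin: "finite F" "finite G" "finite M"
    using F G by (auto simp: idempotent_system_def M_def)
  have eig: "x \<odot> \<Sum>{c \<in> H. t c = m} = m *\<^sub>R \<Sum>{c \<in> H. t c = m}"
    if "idempotent_system H" "x = (\<Sum>c\<in>H. t c *\<^sub>R c)" for H t m
    unfolding jp_sum_right scaleR_sum_right
    using idempotent_system_eigenvector[OF that(1), of _ t] that(2) by (intro sum.cong) auto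
  have W: "x \<odot> W m = m *\<^sub>R W m" for m
  proof -
    have "x \<odot> \<Sum>{c \<in> F. r c = m} = m *\<^sub>R \<Sum>{c \<in> F. r c = m}"
      by (rule eig[OF F x_def])
    moreover have "x \<odot> \<Sum>{d \<in> G. s d = m} = m *\<^sub>R \<Sum>{d \<in> G. s d = m}"
      using eq by (intro eig[OF G]) (simp add: x_def)
    ultimately show ?thesis
      by (simp add: W_def jp_distrib scaleR_diff_right)
  qed
  have orth: "inner (W m) (W l) = 0" if "m \<noteq> l" for m l
  proof -
    have "m * inner (W m) (W l) = l * inner (W m) (W l)"
      using inner_assoc[of x "W m" "W l"] W by simp
    then show ?thesis
      using that by simp
  qed
  have "(\<Sum>m\<in>M. \<Sum>{c \<in> F. r c = m}) = \<Sum>F"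
    using fin by (intro sum.group) (auto simp: M_def)
  moreover have "(\<Sum>m\<in>M. \<Sum>{d \<in> G. s d = m}) = \<Sum>G"
    using fin by (intro sum.group) (auto simp: M_def)
  ultimately have sum0: "(\<Sum>m\<in>M. W m) = 0"
    using F G by (simp add: W_def sum_subtractf idempotent_system_def)
  have "W m = 0"
  proof (cases "m \<in> M")
    case True
    have "0 = inner (W m) (\<Sum>l\<in>M. W l)"
      by (simp add: sum0)
    also have "\<dots> = (\<Sum>l\<in>M. if l = m then inner (W m) (W m) else 0)"
      unfolding inner_sum_right using orth by (intro sum.cong) auto
    also have "\<dots> = inner (W m) (W m)"
      using True fin by simp
    finally show ?thesis
      by simp
  next
    case False
    then have "{c \<in> F. r c = m} = {}" "{d \<in> G. s d = m} = {}"
      by (auto simp: M_def)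
    then show ?thesis
      by (simp only: W_def sum.empty diff_0_right)
  qed
  then show ?thesis
    by (simp add: W_def)
qed

text \<open>Grouped by coefficient value, either side is a combination of spectral idempotents, and
  these agree. With the square root for \<open>g\<close> this makes \<open>jordan_sqrt\<close> well
  defined.\<close>

lemma functional_calculus_unique:
  assumes F: "idempotent_system F" and G: "idempotent_system G"
    and eq: "(\<Sum>c\<in>F. r c *\<^sub>R c) = (\<Sum>d\<in>G. s d *\<^sub>R d)"
  shows "(\<Sum>c\<in>F. g (r c) *\<^sub>R c) = (\<Sum>d\<in>G. g (s d) *\<^sub>R d)"
proof -
  define M where "M = r ` F \<union> s ` G"
  have fin: "finite F" "finite G" "finite M"
    using F G by (auto simp: idempotent_system_def M_def)
  have "(\<Sum>c\<in>F. g (r c) *\<^sub>R c) = (\<Sum>m\<in>M. \<Sum>c\<in>{c \<in> F. r c = m}. g (r c) *\<^sub>R c)"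
    using fin by (intro sum.group[symmetric]) (auto simp: M_def)
  also have "\<dots> = (\<Sum>m\<in>M. g m *\<^sub>R \<Sum>{c \<in> F. r c = m})"
    by (intro sum.cong) (auto simp: scaleR_sum_right)
  also have "\<dots> = (\<Sum>m\<in>M. g m *\<^sub>R \<Sum>{d \<in> G. s d = m})"
    by (simp only: spectral_idempotent_unique[OF F G eq])
  also have "\<dots> = (\<Sum>m\<in>M. \<Sum>d\<in>{d \<in> G. s d = m}. g (s d) *\<^sub>R d)"
    by (intro sum.cong) (auto simp: scaleR_sum_right)
  also have "\<dots> = (\<Sum>d\<in>G. g (s d) *\<^sub>R d)"
    using fin by (intro sum.group) (auto simp: M_def)
  finally show ?thesis .
qed

lemma idempotent_mult_sum:
  assumes F: "idempotent_system F" and S: "S \<subseteq> F" and c: "c \<in> S"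
  shows "c \<odot> \<Sum>S = c"
proof -
  have "finite S"
    using F S finite_subset by (auto simp: idempotent_system_def)
  have "c \<odot> d = (if d = c then c else 0)" if "d \<in> S" for d
  proof -
    have "c \<in> F" "d \<in> F"
      using S c that by auto
    then show ?thesis
      using F by (auto simp: idempotent_system_def)
  qed
  then have "c \<odot> \<Sum>S = (\<Sum>d\<in>S. if d = c then c else 0)"
    unfolding jp_sum_right by (intro sum.cong) auto
  also have "\<dots> = c"
    using c \<open>finite S\<close> by simp
  finally show ?thesis .
qed

lemma idempotent_sum:
  assumes "idempotent_system F" "S \<subseteq> F"
  shows "\<Sum>S \<odot> \<Sum>S = \<Sum>S"
  using idempotent_mult_sum[OF assms] by (simp add: jp_sum_left[of "\<lambda>c. c"])

lemma idempotent_sum_nonzero: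
  assumes F: "idempotent_system F" and S: "S \<subseteq> F" and c: "c \<in> S"
  shows "\<Sum>S \<noteq> 0"
proof
  assume "\<Sum>S = 0"
  then have "c = 0"
    using idempotent_mult_sum[OF assms] by simp
  then show False
    using F S c by (auto simp: idempotent_system_def)
qed

text \<open>With two or more members, separating one of them would write the sum as two nonzero
  idempotents.\<close>

lemma primitive_sum_card:
  assumes F: "idempotent_system F" and S: "S \<subseteq> F" and prim: "primitive_idempotent jp (\<Sum>S)"
  shows "card S = 1"
proof -
  have fin: "finite S"
    using F S finite_subset by (auto simp: idempotent_system_def)
  have "S \<noteq> {}"
    using prim by (auto simp: primitive_idempotent_def)
  then obtain u where u: "u \<in> S" by blast
  have "S - {u} = {}"
  proof (rule ccontr)
    assume "S - {u} \<noteq> {}"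
    then obtain v where v: "v \<in> S - {u}" by blast
    have sub: "S - {u} \<subseteq> F"
      using S by blast
    have "\<Sum>S = u + \<Sum>(S - {u})"
      using sum.remove[OF fin u, of "\<lambda>c. c"] by simp
    moreover have "u \<odot> u = u" "u \<noteq> 0"
      using F S u by (auto simp: idempotent_system_def)
    moreover note idempotent_sum[OF F sub] idempotent_sum_nonzero[OF F sub v]
    ultimately show False
      using prim unfolding primitive_idempotent_def idempotent_def by blast
  qed
  then have "S = {u}"
    using u by blast
  then show ?thesis by simp
qed

lemma eigenvalues_eqI:
  assumes "\<And>F r. spectral_decomposition jp e x F r \<Longrightarrow> image_mset r (mset_set F) = N"
  shows "eigenvalues jp e x = N"
  unfolding eigenvalues_def
proof (rule the_equality)
  show "\<exists>F r. spectral_decomposition jp e x F r \<and> N = image_mset r (mset_set F)"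
    using assms spectral_decomposition_exists by metis
qed (use assms in auto)

text \<open>Distinct coefficients make each nonzero spectral idempotent a single primitive element,
  so any other decomposition also has exactly one member there. The argument makes no use of traces,
  so it can serve to evaluate them.\<close>

lemma eigenvalues_distinct:
  assumes F: "jordan_frame jp e F" and inj: "inj_on r F"
  shows "eigenvalues jp e (\<Sum>c\<in>F. r c *\<^sub>R c) = image_mset r (mset_set F)"
proof (rule eigenvalues_eqI)
  fix G s
  assume "spectral_decomposition jp e (\<Sum>c\<in>F. r c *\<^sub>R c) G s"
  then have G: "jordan_frame jp e G" and eq: "(\<Sum>c\<in>F. r c *\<^sub>R c) = (\<Sum>d\<in>G. s d *\<^sub>R d)"
    by (auto simp: spectral_decomposition_def)
  note F' = jordan_frame_idempotent_system[OF F] and G' = jordan_frame_idempotent_system[OF G]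
  have fin: "finite F" "finite G"
    using F G by (auto simp: jordan_frame_def)
  show "image_mset s (mset_set G) = image_mset r (mset_set F)"
  proof (rule multiset_eqI)
    fix m
    have sums: "\<Sum>{c \<in> F. r c = m} = \<Sum>{d \<in> G. s d = m}"
      by (rule spectral_idempotent_unique[OF F' G' eq])
    have "card {d \<in> G. s d = m} = card {c \<in> F. r c = m}"
    proof (cases "m \<in> r ` F")
      case True
      then obtain c where c: "c \<in> F" "r c = m" by blast
      then have "{c \<in> F. r c = m} = {c}"
        using inj by (auto simp: inj_on_def)
      moreover from this have "primitive_idempotent jp (\<Sum>{d \<in> G. s d = m})"
        using F c by (simp add: jordan_frame_def flip: sums)
      then have "card {d \<in> G. s d = m} = 1"
        by (intro primitive_sum_card[OF G']) auto
      ultimately show ?thesis by simp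
    next
      case False
      then have empty: "{c \<in> F. r c = m} = {}" by blast
      have "{d \<in> G. s d = m} = {}"
      proof (rule equals0I)
        fix d assume "d \<in> {d \<in> G. s d = m}"
        then have "\<Sum>{d \<in> G. s d = m} \<noteq> 0"
          by (intro idempotent_sum_nonzero[OF G']) auto
        then show False
          using sums[unfolded empty sum.empty] by metis
      qed
      then show ?thesis
        by (simp only: empty)
    qed
    then show "count (image_mset s (mset_set G)) m = count (image_mset r (mset_set F)) m"
      using fin by (simp add: count_image_mset_eq_card_vimage)
  qed
qed

end

section \<open>Frames and eigenvalues under the trace form\<close>

locale trace_jordan_algebra = euclidean_jordan_algebra +
  assumes trace_inner: "inner x y = jordan_trace jp e (x \<odot> y)"
begin

text \<open>For an element with pairwise distinct coefficients on a frame the eigenvalues are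
  well defined without further ado; varying the coefficients pins down the trace of each
  frame element.\<close>

lemma frame_inner_unit:
  assumes F: "jordan_frame jp e F" and c: "c \<in> F"
  shows "inner c e = 1"
proof -
  have fin: "finite F"
    using F by (simp add: jordan_frame_def)
  have trace: "(\<Sum>d\<in>F. r d * inner d e) = (\<Sum>d\<in>F. r d)" if "inj_on r F" for r
  proof -
    have "(\<Sum>d\<in>F. r d * inner d e) = inner (\<Sum>d\<in>F. r d *\<^sub>R d) e"
      by (simp add: inner_sum_left)
    also have "\<dots> = jordan_trace jp e (\<Sum>d\<in>F. r d *\<^sub>R d)"
      using trace_inner[of "\<Sum>d\<in>F. r d *\<^sub>R d" e] by simp
    also have "\<dots> = (\<Sum>d\<in>F. r d)"
      unfolding jordan_trace_def eigenvalues_distinct[OF F that] by (simp add: sum_unfold_sum_mset)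
    finally show ?thesis .
  qed
  obtain i :: "'a \<Rightarrow> nat" where i: "inj_on i F"
    using finite_imp_inj_to_nat_seg[OF fin] by blast
  define r where "r d = real (i d)" for d
  \<comment> \<open>No natural number equals \<open>- 1\<close>, so \<open>r'\<close> is still
    injective; subtracting the trace identities of \<open>r\<close> and \<open>r'\<close> leaves
    only the term of \<open>c\<close>.\<close>
  define r' where "r' = r(c := - 1)"
  have "inj_on r F" "inj_on r' F"
    using i by (auto simp: r_def r'_def inj_on_def)
  have split: "sum h F = h c + sum h (F - {c})" for h :: "'a \<Rightarrow> real"
    by (rule sum.remove[OF fin c])
  have rest: "(\<Sum>d\<in>F - {c}. r' d * inner d e) = (\<Sum>d\<in>F - {c}. r d * inner d e)"
    "(\<Sum>d\<in>F - {c}. r' d) = (\<Sum>d\<in>F - {c}. r d)"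
    by (auto intro!: sum.cong simp: r'_def)
  have "(r c - r' c) * inner c e = r c - r' c"
    using trace[OF \<open>inj_on r F\<close>] trace[OF \<open>inj_on r' F\<close>]
    unfolding split[of "\<lambda>d. r d * inner d e"] split[of "\<lambda>d. r' d * inner d e"] split[of r] split[of r'] rest
    by (simp add: algebra_simps)
  moreover have "r c - r' c \<noteq> 0"
    by (simp add: r_def r'_def add_nonneg_eq_0_iff)
  ultimately show ?thesis by simp
qed

lemma frame_subset_inner_unit:
  assumes F: "jordan_frame jp e F" and S: "S \<subseteq> F"
  shows "inner (\<Sum>S) e = real (card S)"
proof -
  have "inner (\<Sum>S) e = (\<Sum>c\<in>S. 1)"
    unfolding inner_sum_left using frame_inner_unit[OF F] S by (intro sum.cong) auto
  then show ?thesis by simp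
qed

text \<open>Each frame element has inner product 1 with \<open>e\<close>, so every frame has
  \<open>inner e e\<close> members.\<close>

lemma jordan_frame_card: "jordan_frame jp e F \<Longrightarrow> card F = jordan_rank jp e"
proof -
  assume F: "jordan_frame jp e F"
  have card: "real (card G) = inner e e" if "jordan_frame jp e G" for G
    using frame_subset_inner_unit[OF that, of G] that by (simp add: jordan_frame_def)
  have "jordan_rank jp e = card F"
    unfolding jordan_rank_def
  proof (rule the_equality)
    fix n assume "\<exists>G. jordan_frame jp e G \<and> card G = n"
    then obtain G where "jordan_frame jp e G" "card G = n"
      by blast
    then have "real n = real (card F)"
      using card[of G] card[OF F] by simp
    then show "n = card F"
      by simp
  qed (use F in blast)
  then show ?thesis ..
qed

text \<open>The multiplicity of \<open>m\<close> is the inner product of its spectral idempotent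
  with \<open>e\<close>, and that idempotent is the same for all decompositions.\<close>

lemma eigenvalues_eq:
  assumes "spectral_decomposition jp e x F r"
  shows "eigenvalues jp e x = image_mset r (mset_set F)"
proof (rule eigenvalues_eqI)
  fix G s
  assume "spectral_decomposition jp e x G s"
  then have G: "jordan_frame jp e G" and F: "jordan_frame jp e F"
    and eq: "(\<Sum>c\<in>F. r c *\<^sub>R c) = (\<Sum>d\<in>G. s d *\<^sub>R d)"
    using assms by (auto simp: spectral_decomposition_def)
  note F' = jordan_frame_idempotent_system[OF F] and G' = jordan_frame_idempotent_system[OF G]
  have "finite F" "finite G"
    using F G by (auto simp: jordan_frame_def)
  have "card {d \<in> G. s d = m} = card {c \<in> F. r c = m}" for m
  proof -
    have "real (card {d \<in> G. s d = m}) = real (card {c \<in> F. r c = m})"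
      using spectral_idempotent_unique[OF F' G' eq, of m]
        frame_subset_inner_unit[OF F, of "{c \<in> F. r c = m}"]
        frame_subset_inner_unit[OF G, of "{d \<in> G. s d = m}"] by simp
    then show ?thesis by simp
  qed
  then show "image_mset s (mset_set G) = image_mset r (mset_set F)"
    using \<open>finite F\<close> \<open>finite G\<close> by (intro multiset_eqI) (simp add: count_image_mset_eq_card_vimage)
qed

lemma jordan_sqrt_eq:
  assumes "spectral_decomposition jp e x F r"
  shows "jordan_sqrt jp e x = (\<Sum>c\<in>F. sqrt (r c) *\<^sub>R c)"
  unfolding jordan_sqrt_def
proof (rule the_equality)
  fix y
  assume "\<exists>G s. spectral_decomposition jp e x G s \<and> y = (\<Sum>c\<in>G. sqrt (s c) *\<^sub>R c)"
  then obtain G s where G: "spectral_decomposition jp e x G s" and y: "y = (\<Sum>c\<in>G. sqrt (s c) *\<^sub>R c)"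
    by blast
  have "idempotent_system G" "idempotent_system F" "(\<Sum>c\<in>G. s c *\<^sub>R c) = (\<Sum>c\<in>F. r c *\<^sub>R c)"
    using assms G jordan_frame_idempotent_system unfolding spectral_decomposition_def by metis+
  then show "y = (\<Sum>c\<in>F. sqrt (r c) *\<^sub>R c)"
    unfolding y by (rule functional_calculus_unique)
qed (use assms in blast)

abbreviation rk :: nat where
  "rk \<equiv> jordan_rank jp e"

abbreviation ev :: "'a \<Rightarrow> nat \<Rightarrow> real" where
  "ev x i \<equiv> eigenvalue_vector jp e x ! i"

text \<open>Under the trace form an idempotent is primitive iff its inner product with \<open>e\<close> is 1.\<close>

definition frame_seq :: "(nat \<Rightarrow> 'a) \<Rightarrow> bool" where
  "frame_seq c \<longleftrightarrow> (\<forall>i<rk. c i \<odot> c i = c i \<and> inner (c i) e = 1) \<and>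
     (\<forall>i<rk. \<forall>j<rk. i \<noteq> j \<longrightarrow> c i \<odot> c j = 0) \<and> (\<Sum>i<rk. c i) = e"

lemma length_eigenvalue_vector: "length (eigenvalue_vector jp e x) = rk"
proof -
  obtain F r where "spectral_decomposition jp e x F r"
    using spectral_decomposition_exists by blast
  then show ?thesis
    using eigenvalues_eq jordan_frame_card
    by (simp add: eigenvalue_vector_def spectral_decomposition_def flip: size_mset)
qed

lemma ev_antimono: "i \<le> j \<Longrightarrow> j < rk \<Longrightarrow> ev x j \<le> ev x i"
  using length_eigenvalue_vector[of x]
  by (intro sorted_rev_nth_mono) (simp_all add: eigenvalue_vector_def sorted_sorted_list_of_multiset)

lemma ev_nonneg: "jordan_nonneg jp e x \<Longrightarrow> i < rk \<Longrightarrow> 0 \<le> ev x i"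
  using nth_mem[of i "eigenvalue_vector jp e x"] length_eigenvalue_vector[of x]
  by (simp add: jordan_nonneg_def eigenvalue_vector_def)

text \<open>Sorting a frame by decreasing coefficient aligns it with
  \<open>eigenvalue_vector\<close>. The square root is included so that both expansions refer to the
  same frame.\<close>

lemma spectral_sequence:
  obtains c where "frame_seq c" "x = (\<Sum>i<rk. ev x i *\<^sub>R c i)"
    "jordan_sqrt jp e x = (\<Sum>i<rk. sqrt (ev x i) *\<^sub>R c i)"
proof -
  obtain F r where Fr: "spectral_decomposition jp e x F r"
    using spectral_decomposition_exists by blast
  then have F: "jordan_frame jp e F" and x: "x = (\<Sum>c\<in>F. r c *\<^sub>R c)"
    by (auto simp: spectral_decomposition_def)
  have sys: "idempotent_system F"
    by (rule jordan_frame_idempotent_system[OF F])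
  have "finite F"
    using F by (simp add: jordan_frame_def)
  then obtain xs where xs: "set xs = F" "distinct xs"
    using finite_distinct_list by blast
  define ys where "ys = rev (sort_key r xs)"
  have ys: "set ys = F" "distinct ys" "length ys = rk"
    using xs jordan_frame_card[OF F] by (auto simp: ys_def distinct_card)
  have "eigenvalues jp e x = mset (map r (sort_key r xs))"
    unfolding eigenvalues_eq[OF Fr] using xs by (simp flip: mset_set_set)
  moreover have "sort (map r (sort_key r xs)) = map r (sort_key r xs)"
    by (intro sorted_sort_id) simp
  ultimately have vec: "eigenvalue_vector jp e x = map r ys"
    unfolding eigenvalue_vector_def ys_def by (simp only: sorted_list_of_multiset_mset rev_map)
  then have ev: "ev x i = r (ys ! i)" if "i < rk" for i
    using that ys by simp
  have bij: "bij_betw ((!) ys) {..<rk} F"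
    using ys by (intro bij_betw_nth) auto
  have reindex: "(\<Sum>i<rk. h (ys ! i)) = (\<Sum>c\<in>F. h c)" for h :: "'a \<Rightarrow> 'a"
    by (rule sum.reindex_bij_betw[OF bij])
  have in_F: "ys ! i \<in> F" if "i < rk" for i
    using that ys by auto
  show ?thesis
  proof (rule that[of "(!) ys"])
    have "ys ! i \<noteq> ys ! j" if "i < rk" "j < rk" "i \<noteq> j" for i j
      using that ys by (simp add: nth_eq_iff_index_eq)
    then show "frame_seq ((!) ys)"
      using sys in_F frame_inner_unit[OF F] reindex[of "\<lambda>c. c"]
      by (simp add: frame_seq_def idempotent_system_def)
    show "x = (\<Sum>i<rk. ev x i *\<^sub>R ys ! i)"
      using reindex[of "\<lambda>c. r c *\<^sub>R c"] x ev by simp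
    show "jordan_sqrt jp e x = (\<Sum>i<rk. sqrt (ev x i) *\<^sub>R ys ! i)"
      using reindex[of "\<lambda>c. sqrt (r c) *\<^sub>R c"] jordan_sqrt_eq[OF Fr] ev by simp
  qed
qed

end

section \<open>Frames and variational inequalities\<close>

context euclidean_jordan_algebra
begin

text \<open>Multiplication by \<open>c\<close> is a root of
  \<open>t * (2 * t - 1) * (t - 1)\<close>; this is \<open>jp_triple\<close> with all three factors
  equal to \<open>c\<close>.\<close>

lemma idempotent_cubic:
  assumes "c \<odot> c = c"
  shows "2 *\<^sub>R (c \<odot> (c \<odot> (c \<odot> w))) = 3 *\<^sub>R (c \<odot> (c \<odot> w)) - c \<odot> w"
proof -
  have "c \<odot> w = c \<odot> (c \<odot> w) + c \<odot> (c \<odot> w) + c \<odot> (c \<odot> w)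
      - c \<odot> (c \<odot> (c \<odot> w)) - c \<odot> (c \<odot> (c \<odot> w))"
    using jp_triple[of c c c w] assms by simp
  moreover have "3 *\<^sub>R (c \<odot> (c \<odot> w)) = c \<odot> (c \<odot> w) + c \<odot> (c \<odot> w) + c \<odot> (c \<odot> w)"
    by (simp add: scaleR_left_distrib[of 1 1] scaleR_left_distrib[of 2 1, simplified] scaleR_2)
  ultimately show ?thesis
    by (simp add: scaleR_2 algebra_simps)
qed

text \<open>The eigenvalues of multiplication by an idempotent lie in \<open>{0, 1/2, 1}\<close>; the two squares
  below are the quadratic forms of the eigenprojections for 1 and 1/2.\<close>

lemma idempotent_operator_nonneg:
  assumes c: "c \<odot> c = c"
  shows "0 \<le> inner (c \<odot> v) v"
proof -
  define p where "p = c \<odot> v"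
  define q where "q = c \<odot> p"
  define s where "s = c \<odot> q"
  have s: "2 *\<^sub>R s = 3 *\<^sub>R q - p"
    unfolding s_def q_def p_def by (rule idempotent_cubic[OF c])
  have "inner (2 *\<^sub>R s) v = 3 * inner q v - inner p v"
    "inner (2 *\<^sub>R s) p = 3 * inner q p - inner p p"
    unfolding s by (simp_all add: inner_diff_left)
  moreover have "inner q v = inner p p" "inner s v = inner q p" "inner s p = inner q q"
    using inner_assoc[of c p v] inner_assoc[of c q v] inner_assoc[of c q p]
    by (simp_all add: p_def[symmetric] q_def[symmetric] s_def[symmetric] del: inner_assoc)
  moreover have "inner (2 *\<^sub>R q - p) (2 *\<^sub>R q - p) = 4 * inner q q - 4 * inner q p + inner p p"
    "inner (p - q) (p - q) = inner p p - 2 * inner q p + inner q q"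
    by (simp_all add: inner_diff_left inner_diff_right inner_commute[of p q])
  ultimately have "inner p v = inner (2 *\<^sub>R q - p) (2 *\<^sub>R q - p) + 8 * inner (p - q) (p - q)"
    by simp
  then show ?thesis
    by (simp add: p_def)
qed

lemma idempotents_inner_nonneg:
  assumes "c \<odot> c = c" "d \<odot> d = d"
  shows "0 \<le> inner c d"
  using idempotent_operator_nonneg[OF assms(1), of d] inner_jp_swap[of c d d] assms(2) by simp

end

context trace_jordan_algebra
begin

lemma rank_pos: "0 < rk"
proof -
  obtain c where "frame_seq c"
    using spectral_sequence by blast
  then show ?thesis
    using unit_nonzero by (cases "rk = 0") (auto simp: frame_seq_def)
qed

lemma frame_inner_nonneg:
  "frame_seq c \<Longrightarrow> frame_seq d \<Longrightarrow> i < rk \<Longrightarrow> j < rk \<Longrightarrow> 0 \<le> inner (c i) (d j)"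
  by (auto simp: frame_seq_def intro: idempotents_inner_nonneg)

text \<open>Together with \<open>frame_inner_nonneg\<close>, used for both orders of the frames,
  this says that the matrix of inner products is doubly stochastic.\<close>

lemma frame_inner_sum:
  assumes "frame_seq c" "frame_seq d" "i < rk"
  shows "(\<Sum>j<rk. inner (c i) (d j)) = 1"
  using assms by (simp add: frame_seq_def flip: inner_sum_right)

lemma frame_norm: "frame_seq c \<Longrightarrow> i < rk \<Longrightarrow> norm (c i) = 1"
  using idempotent_inner_unit[of "c i"] by (simp add: frame_seq_def norm_eq_1)

lemma frame_eigenvector:
  assumes c: "frame_seq c" and j: "j < rk"
  shows "(\<Sum>i<rk. u i *\<^sub>R c i) \<odot> c j = u j *\<^sub>R c j"
proof -
  have "(\<Sum>i<rk. u i *\<^sub>R c i) \<odot> c j = (\<Sum>i<rk. if i = j then u j *\<^sub>R c j else 0)"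
    unfolding jp_sum_left using c j by (intro sum.cong) (auto simp: frame_seq_def)
  then show ?thesis
    using j by simp
qed

lemma frame_coefficient:
  assumes c: "frame_seq c" and j: "j < rk"
  shows "inner (c j) (\<Sum>i<rk. u i *\<^sub>R c i) = u j"
proof -
  have "inner (c j) (\<Sum>i<rk. u i *\<^sub>R c i) = inner ((\<Sum>i<rk. u i *\<^sub>R c i) \<odot> c j) e"
    using inner_jp_swap[of "\<Sum>i<rk. u i *\<^sub>R c i" "c j" e] by (simp add: inner_commute)
  also have "\<dots> = u j"
    unfolding frame_eigenvector[OF assms] using assms by (simp add: frame_seq_def)
  finally show ?thesis .
qed

text \<open>Adding \<open>k\<close> rows of the doubly stochastic matrix of the two frames gives
  column weights in [0, 1] of total \<open>k\<close>, and \<open>weighted_sum_le_top_sum\<close>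
  applies.\<close>

lemma ky_fan_top:
  assumes c: "frame_seq c" and d: "frame_seq d" and k: "k \<le> rk"
    and dec: "\<And>i j. i \<le> j \<Longrightarrow> j < rk \<Longrightarrow> u j \<le> u i"
  shows "(\<Sum>i<k. inner (c i) (\<Sum>j<rk. u j *\<^sub>R d j)) \<le> (\<Sum>i<k. u i)"
proof -
  define w where "w j = (\<Sum>i<k. inner (c i) (d j))" for j
  have nonneg: "0 \<le> inner (c i) (d j)" if "i < rk" "j < rk" for i j
    using frame_inner_nonneg[OF c d] that by simp
  have w1: "w j \<le> 1" if "j < rk" for j
  proof -
    have "w j \<le> (\<Sum>i<rk. inner (c i) (d j))"
      unfolding w_def using k that nonneg by (intro sum_mono2) auto
    also have "\<dots> = 1"
      using frame_inner_sum[OF d c that] by (simp add: inner_commute)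
    finally show ?thesis .
  qed
  have "(\<Sum>i<k. inner (c i) (\<Sum>j<rk. u j *\<^sub>R d j)) = (\<Sum>j<rk. w j * u j)"
    unfolding w_def sum_distrib_right inner_sum_right
    by (subst sum.swap) (simp add: mult.commute)
  also have "\<dots> \<le> (\<Sum>j<k. u j)"
  proof (rule weighted_sum_le_top_sum)
    show "0 \<le> w j" if "j < rk" for j
      unfolding w_def using nonneg that k by (intro sum_nonneg) auto
    have "(\<Sum>j<rk. w j) = (\<Sum>i<k. \<Sum>j<rk. inner (c i) (d j))"
      unfolding w_def by (rule sum.swap)
    also have "\<dots> = (\<Sum>i<k. 1)"
      using k frame_inner_sum[OF c d] by (intro sum.cong) auto
    finally show "(\<Sum>j<rk. w j) = real k"
      by simp
  qed (use w1 k dec in auto)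
  finally show ?thesis .
qed

lemma frame_trace:
  assumes c: "frame_seq c" and d: "frame_seq d"
  shows "(\<Sum>i<rk. inner (c i) (\<Sum>j<rk. u j *\<^sub>R d j)) = (\<Sum>j<rk. u j)"
proof -
  have "(\<Sum>i<rk. inner (c i) (\<Sum>j<rk. u j *\<^sub>R d j)) = (\<Sum>j<rk. u j * (\<Sum>i<rk. inner (d j) (c i)))"
    unfolding inner_sum_right sum_distrib_left
    by (subst sum.swap) (simp add: inner_commute)
  also have "\<dots> = (\<Sum>j<rk. u j)"
    using frame_inner_sum[OF d c] by simp
  finally show ?thesis .
qed

text \<open>Both full sums equal the trace, so the bound for the first \<open>k\<close> terms
  reverses for the remaining ones.\<close>

lemma ky_fan_bottom:
  assumes c: "frame_seq c" and d: "frame_seq d" and k: "k \<le> rk"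
    and dec: "\<And>i j. i \<le> j \<Longrightarrow> j < rk \<Longrightarrow> u j \<le> u i"
  shows "(\<Sum>i=k..<rk. u i) \<le> (\<Sum>i=k..<rk. inner (c i) (\<Sum>j<rk. u j *\<^sub>R d j))"
  using ky_fan_top[OF assms] frame_trace[OF c d, of u] by (simp add: sum_tail[OF k])

text \<open>The inner product is a convex combination of the eigenvalues of \<open>x\<close>, the
  least of which has index \<open>rk - 1\<close>.\<close>

lemma eigenvalue_le_frame_inner:
  assumes c: "frame_seq c" and i: "i < rk"
  shows "ev x (rk - 1) \<le> inner (c i) x"
proof -
  obtain d where d: "frame_seq d" and x: "x = (\<Sum>j<rk. ev x j *\<^sub>R d j)"
    using spectral_sequence by blast
  have "ev x (rk - 1) = (\<Sum>j<rk. ev x (rk - 1) * inner (c i) (d j))"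
    using frame_inner_sum[OF c d i] by (simp flip: sum_distrib_left)
  also have "\<dots> \<le> (\<Sum>j<rk. ev x j * inner (c i) (d j))"
    using frame_inner_nonneg[OF c d i] by (intro sum_mono mult_right_mono ev_antimono) auto
  also have "\<dots> = inner (c i) x"
    by (subst (2) x) (simp add: inner_sum_right)
  finally show ?thesis .
qed

lemma eigenvalue_frame_inner:
  assumes "frame_seq c" "x = (\<Sum>i<rk. ev x i *\<^sub>R c i)" "i < rk"
  shows "inner (c i) x = ev x i"
  by (subst assms(2)) (rule frame_coefficient[OF assms(1,3)])

section \<open>Continuity of ordered eigenvalues\<close>

text \<open>The frame diagonalising \<open>y\<close> attains its top sum and serves as a trial frame
  for \<open>x\<close> in \<open>ky_fan_top\<close>; Cauchy-Schwarz bounds the difference.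
  Exchanging \<open>x\<close> and \<open>y\<close> gives a Lipschitz bound.\<close>

lemma top_eigenvalues_diff:
  assumes k: "k \<le> rk"
  shows "(\<Sum>i<k. ev y i) - (\<Sum>i<k. ev x i) \<le> real k * norm (y - x)"
proof -
  obtain c where c: "frame_seq c" and y: "y = (\<Sum>j<rk. ev y j *\<^sub>R c j)"
    using spectral_sequence by blast
  obtain d where d: "frame_seq d" and x: "x = (\<Sum>j<rk. ev x j *\<^sub>R d j)"
    using spectral_sequence by blast
  have "(\<Sum>i<k. inner (c i) x) \<le> (\<Sum>i<k. ev x i)"
    using ky_fan_top[OF c d k, of "ev x"] ev_antimono x by simp
  moreover have "(\<Sum>i<k. ev y i) = (\<Sum>i<k. inner (c i) y)"
    using eigenvalue_frame_inner[OF c y] k by (intro sum.cong) auto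
  ultimately have "(\<Sum>i<k. ev y i) - (\<Sum>i<k. ev x i) \<le> (\<Sum>i<k. inner (c i) (y - x))"
    by (simp add: inner_diff_right sum_subtractf)
  also have "\<dots> \<le> (\<Sum>i<k. norm (y - x))"
  proof (rule sum_mono)
    fix i assume "i \<in> {..<k}"
    then show "inner (c i) (y - x) \<le> norm (y - x)"
      using norm_cauchy_schwarz[of "c i" "y - x"] frame_norm[OF c, of i] k by simp
  qed
  finally show ?thesis by simp
qed

lemma tendsto_top_eigenvalues:
  assumes X: "(X \<longlongrightarrow> x) G" and k: "k \<le> rk"
  shows "((\<lambda>t. \<Sum>i<k. ev (X t) i) \<longlongrightarrow> (\<Sum>i<k. ev x i)) G"
proof (rule LIM_zero_cancel, rule Lim_null_comparison)
  show "\<forall>\<^sub>F t in G. norm ((\<Sum>i<k. ev (X t) i) - (\<Sum>i<k. ev x i)) \<le> real k * norm (X t - x)"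
    using top_eigenvalues_diff[OF k] by (intro always_eventually) (metis abs_diff_le_iff abs_le_iff minus_diff_eq norm_minus_commute real_norm_def)
  show "((\<lambda>t. real k * norm (X t - x)) \<longlongrightarrow> 0) G"
    using X by (intro tendsto_mult_right_zero tendsto_norm_zero LIM_zero)
qed

lemma tendsto_eigenvalue:
  assumes X: "(X \<longlongrightarrow> x) G" and i: "i < rk"
  shows "((\<lambda>t. ev (X t) i) \<longlongrightarrow> ev x i) G"
proof -
  have "((\<lambda>t. (\<Sum>j<Suc i. ev (X t) j) - (\<Sum>j<i. ev (X t) j)) \<longlongrightarrow> (\<Sum>j<Suc i. ev x j) - (\<Sum>j<i. ev x j)) G"
    using X i by (intro tendsto_diff tendsto_top_eigenvalues) auto
  then show ?thesis by simp
qed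

text \<open>\<open>L\<close> is the logarithm of \<open>x\<close>: \<open>ky_fan_bottom\<close>
  compares its eigenvalues with its diagonal in the frame \<open>c\<close>, and Jensen's inequality
  compares each diagonal entry with the logarithm of that of \<open>x\<close>.\<close>

lemma sum_ln_eigenvalues_le:
  assumes c: "frame_seq c" and k: "k \<le> rk" and pos: "\<And>i. i < rk \<Longrightarrow> 0 < ev x i"
  shows "(\<Sum>i=k..<rk. ln (ev x i)) \<le> (\<Sum>i=k..<rk. ln (inner (c i) x))"
proof -
  obtain d where d: "frame_seq d" and x: "x = (\<Sum>j<rk. ev x j *\<^sub>R d j)"
    using spectral_sequence by blast
  define L where "L = (\<Sum>j<rk. ln (ev x j) *\<^sub>R d j)"
  have "(\<Sum>i=k..<rk. ln (ev x i)) \<le> (\<Sum>i=k..<rk. inner (c i) L)"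
    unfolding L_def using pos ev_antimono by (intro ky_fan_bottom[OF c d k]) simp
  also have "\<dots> \<le> (\<Sum>i=k..<rk. ln (inner (c i) x))"
  proof (rule sum_mono)
    \<comment> \<open>Jensen's inequality for the logarithm, via its tangent at the mean \<open>z\<close>\<close>
    fix i assume "i \<in> {k..<rk}"
    then have i: "i < rk" by simp
    define w where "w j = inner (c i) (d j)" for j
    define z where "z = inner (c i) x"
    have w: "0 \<le> w j" if "j < rk" for j
      unfolding w_def using frame_inner_nonneg[OF c d i that] .
    have w1: "(\<Sum>j<rk. w j) = 1"
      unfolding w_def by (rule frame_inner_sum[OF c d i])
    have z: "z = (\<Sum>j<rk. w j * ev x j)"
      unfolding z_def w_def by (subst x) (simp add: inner_sum_right mult.commute)
    have "0 < z"
      using eigenvalue_le_frame_inner[OF c i, of x] pos[of "rk - 1"] rank_pos by (simp add: z_def)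
    have "inner (c i) L = (\<Sum>j<rk. w j * ln (ev x j))"
      unfolding L_def w_def by (simp add: inner_sum_right mult.commute)
    also have "\<dots> \<le> (\<Sum>j<rk. w j * (ev x j / z - 1 + ln z))"
    proof (rule sum_mono)
      fix j assume "j \<in> {..<rk}"
      then have j: "j < rk" by simp
      have "ln (ev x j / z) \<le> ev x j / z - 1"
        using pos[OF j] \<open>0 < z\<close> by (intro ln_le_minus_one) simp
      then have "ln (ev x j) \<le> ev x j / z - 1 + ln z"
        using pos[OF j] \<open>0 < z\<close> by (simp add: ln_div)
      then show "w j * ln (ev x j) \<le> w j * (ev x j / z - 1 + ln z)"
        using w[OF j] by (rule mult_left_mono)
    qed
    also have "\<dots> = (\<Sum>j<rk. w j * ev x j) / z + (\<Sum>j<rk. w j) * (ln z - 1)"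
      unfolding sum_divide_distrib sum_distrib_right sum.distrib[symmetric]
      by (intro sum.cong refl) (simp add: algebra_simps)
    also have "\<dots> = ln z"
      using \<open>0 < z\<close> w1 by (simp flip: z)
    finally show "inner (c i) L \<le> ln (inner (c i) x)"
      by (simp add: z_def)
  qed
  finally show ?thesis .
qed

end

section \<open>The flow from \<open>b\<close> to the quadratic representation\<close>

context euclidean_jordan_algebra
begin

text \<open>This puts \<open>c \<odot> (d \<odot> w)\<close> into the Peirce 1/2-space of
  \<open>c\<close>. In \<open>jp_triple\<close> at \<open>c\<close>, \<open>d\<close>,
  \<open>c\<close> the products \<open>c \<odot> d\<close> vanish and the last two terms coincide by
  commutation.\<close>

lemma orthogonal_idempotents_square:
  assumes "c \<odot> c = c" "c \<odot> d = 0"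
  shows "c \<odot> (c \<odot> (d \<odot> w)) = (1/2) *\<^sub>R (c \<odot> (d \<odot> w))"
proof -
  have "d \<odot> (c \<odot> (c \<odot> w)) = c \<odot> (c \<odot> (d \<odot> w))"
    by (simp add: orthogonal_idempotent_commute[OF assms])
  then have "c \<odot> (d \<odot> w) = 2 *\<^sub>R (c \<odot> (c \<odot> (d \<odot> w)))"
    using jp_triple[of c d c w] assms commute[of d c] by (simp add: scaleR_2 algebra_simps)
  then have "(1/2) *\<^sub>R (c \<odot> (d \<odot> w)) = (1/2) *\<^sub>R (2 *\<^sub>R (c \<odot> (c \<odot> (d \<odot> w))))"
    by (simp only:)
  then show ?thesis
    by simp
qed

text \<open>In \<open>jp_triple\<close> at \<open>c\<close>, \<open>d\<close>, \<open>u\<close> only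
  two terms survive; they have the same sign and coincide by commutation, so both vanish.\<close>

lemma orthogonal_idempotents_triple:
  assumes "c \<odot> c = c" "d \<odot> d = d" "c \<odot> d = 0" "c \<odot> u = 0" "d \<odot> u = 0"
  shows "c \<odot> (u \<odot> (d \<odot> w)) = 0"
proof -
  have "d \<odot> (u \<odot> (c \<odot> w)) = d \<odot> (c \<odot> (u \<odot> w))"
    by (simp add: orthogonal_idempotent_commute[OF assms(1,4)])
  also have "\<dots> = c \<odot> (d \<odot> (u \<odot> w))"
    by (simp add: orthogonal_idempotent_commute[OF assms(1,3)])
  also have "\<dots> = c \<odot> (u \<odot> (d \<odot> w))"
    by (simp add: orthogonal_idempotent_commute[OF assms(2,5)])
  finally have "c \<odot> (u \<odot> (d \<odot> w)) + c \<odot> (u \<odot> (d \<odot> w)) = 0"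
    using jp_triple[of c d u w] assms by (simp add: neg_eq_iff_add_eq_0)
  then show ?thesis
    by (simp flip: scaleR_2)
qed

text \<open>Off the diagonal this is half the Peirce component of \<open>b\<close>, since the sums below run over
  both orders of the indices.\<close>

definition peirce :: "(nat \<Rightarrow> 'a) \<Rightarrow> nat \<Rightarrow> nat \<Rightarrow> 'a \<Rightarrow> 'a" where
  "peirce f i j b = 2 *\<^sub>R (f i \<odot> (f j \<odot> b)) - (f i \<odot> f j) \<odot> b"

lemma quadratic_rep_sum:
  "quadratic_rep jp (\<Sum>i<n. u i *\<^sub>R f i) b = (\<Sum>i<n. \<Sum>j<n. (u i * u j) *\<^sub>R peirce f i j b)"
proof -
  define U where "U = (\<Sum>i<n. u i *\<^sub>R f i)"
  have U: "U \<odot> v = (\<Sum>i<n. u i *\<^sub>R (f i \<odot> v))" for v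
    by (simp add: U_def jp_sum_left)
  have "f i \<odot> (U \<odot> b) = (\<Sum>j<n. u j *\<^sub>R (f i \<odot> (f j \<odot> b)))" for i
    by (simp add: U jp_sum_right)
  then have "U \<odot> (U \<odot> b) = (\<Sum>i<n. \<Sum>j<n. (u i * u j) *\<^sub>R (f i \<odot> (f j \<odot> b)))"
    by (simp add: U[of "U \<odot> b"] scaleR_sum_right)
  moreover have "(f i \<odot> U) \<odot> b = (\<Sum>j<n. u j *\<^sub>R ((f i \<odot> f j) \<odot> b))" for i
    by (simp add: U_def jp_sum_left jp_sum_right)
  then have "(U \<odot> U) \<odot> b = (\<Sum>i<n. \<Sum>j<n. (u i * u j) *\<^sub>R ((f i \<odot> f j) \<odot> b))"
    by (simp add: U[of U] jp_sum_left scaleR_sum_right)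
  ultimately show ?thesis
    unfolding quadratic_rep_def U_def[symmetric] peirce_def
    by (simp add: scaleR_diff_right sum_subtractf scaleR_sum_right mult_ac)
qed

end

context trace_jordan_algebra
begin

text \<open>One formula for all Peirce eigenvalues: a diagonal component has 1 under its own
  idempotent, an off-diagonal one has 1/2 under each of its two, and every other idempotent gives
  0.\<close>

lemma peirce_eigenvector:
  assumes f: "frame_seq f" and ijk: "i < rk" "j < rk" "k < rk"
  shows "f k \<odot> peirce f i j b = ((of_bool (k = i) + of_bool (k = j)) / 2) *\<^sub>R peirce f i j b"
proof -
  have idem: "f i \<odot> f i = f i" if "i < rk" for i
    using f that by (simp add: frame_seq_def)
  have orth: "f i \<odot> f j = 0" if "i < rk" "j < rk" "i \<noteq> j" for i j
    using f that by (simp add: frame_seq_def)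
  have comm: "f i \<odot> (f j \<odot> w) = f j \<odot> (f i \<odot> w)" if "i < rk" "j < rk" "i \<noteq> j" for i j w
    using that idem orth by (intro orthogonal_idempotent_commute) auto
  have square: "f i \<odot> (f i \<odot> (f j \<odot> w)) = (1/2) *\<^sub>R (f i \<odot> (f j \<odot> w))"
    if "i < rk" "j < rk" "i \<noteq> j" for i j w
    using that idem orth by (intro orthogonal_idempotents_square) auto
  show ?thesis
  proof (cases "i = j")
    case True
    show ?thesis
    proof (cases "k = i")
      case True
      then show ?thesis
        using idempotent_cubic[OF idem, of i b] \<open>i = j\<close> ijk
        by (simp add: peirce_def idem jp_distrib scaleR_left_distrib[of 2 1, simplified] scaleR_2)
    next
      case False
      \<comment> \<open>The factor 1/2 gained below cancels the 2 in \<open>peirce\<close>, so the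
        two parts of the diagonal component annihilate each other under \<open>f k\<close>.\<close>
      have "f k \<odot> (f i \<odot> (f i \<odot> b)) = f i \<odot> (f i \<odot> (f k \<odot> b))"
        using comm[of k i] False ijk by simp
      also have "\<dots> = (1/2) *\<^sub>R (f k \<odot> (f i \<odot> b))"
        using square[of i k b] comm[of k i b] False ijk by simp
      finally show ?thesis
        using \<open>i = j\<close> False ijk by (simp add: peirce_def idem jp_distrib)
    qed
  next
    case False
    then have p: "peirce f i j b = 2 *\<^sub>R (f i \<odot> (f j \<odot> b))"
      using ijk by (simp add: peirce_def orth)
    consider "k = i" | "k = j" | "k \<noteq> i" "k \<noteq> j" by blast
    then show ?thesis
    proof cases
      case 1
      then show ?thesis
        using square[of i j b] False ijk by (simp add: p)
    next
      case 2
      then show ?thesis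
        using square[of j i b] comm[of i j b] False ijk by (simp add: p)
    next
      case 3
      have "f k \<odot> (f i \<odot> (f j \<odot> b)) = 0"
        using 3 False ijk idem orth by (intro orthogonal_idempotents_triple) auto
      then show ?thesis
        using 3 by (simp add: p)
    qed
  qed
qed

text \<open>Here \<open>l\<close> lists the logarithms of the eigenvalues of \<open>a\<close> on the
  frame \<open>f\<close>; halving the exponent makes time 1 correspond to the square root of
  \<open>a\<close>.\<close>

definition flow :: "(nat \<Rightarrow> 'a) \<Rightarrow> (nat \<Rightarrow> real) \<Rightarrow> 'a \<Rightarrow> real \<Rightarrow> 'a" where
  "flow f l b t = quadratic_rep jp (\<Sum>i<rk. exp (t * l i / 2) *\<^sub>R f i) b"

lemma flow_expand:
  "flow f l b t = (\<Sum>i<rk. \<Sum>j<rk. exp (t * ((l i + l j) / 2)) *\<^sub>R peirce f i j b)"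
  unfolding flow_def quadratic_rep_sum
  by (intro sum.cong refl) (simp add: algebra_simps add_divide_distrib flip: exp_add)

lemma flow_0: "frame_seq f \<Longrightarrow> flow f l b 0 = b"
  by (simp add: flow_def frame_seq_def quadratic_rep_def scaleR_2)

text \<open>The eigenvalue is exactly the exponent in \<open>flow_expand\<close>, so the flow solves
  the linear equation generated by multiplication with the logarithm of \<open>a\<close>.\<close>

lemma peirce_generator:
  assumes f: "frame_seq f" and ij: "i < rk" "j < rk"
  shows "(\<Sum>k<rk. l k *\<^sub>R f k) \<odot> peirce f i j b = ((l i + l j) / 2) *\<^sub>R peirce f i j b"
proof -
  have "(\<Sum>k<rk. l k *\<^sub>R f k) \<odot> peirce f i j b
      = (\<Sum>k<rk. (l k * ((of_bool (k = i) + of_bool (k = j)) / 2))) *\<^sub>R peirce f i j b"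
    unfolding jp_sum_left scaleR_sum_left
    using peirce_eigenvector[OF f ij] by (intro sum.cong) auto
  also have "(\<Sum>k<rk. (l k * ((of_bool (k = i) + of_bool (k = j)) / 2)))
      = (\<Sum>k<rk. (if k = i then l i / 2 else 0) + (if k = j then l j / 2 else 0))"
    by (intro sum.cong) auto
  also have "\<dots> = (l i + l j) / 2"
    using ij by (simp add: sum.distrib add_divide_distrib)
  finally show ?thesis .
qed

text \<open>Integrated form of that linear equation, obtained from \<open>exp_second_order\<close>
  on each Peirce component; the error constant is uniform on [0, 1].\<close>

lemma flow_second_order:
  assumes f: "frame_seq f"
  obtains C where "0 \<le> C"
    "\<And>s t. 0 \<le> s \<Longrightarrow> s \<le> 1 \<Longrightarrow> 0 \<le> t \<Longrightarrow> t \<le> 1 \<Longrightarrow>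
      norm (flow f l b s - flow f l b t - (s - t) *\<^sub>R ((\<Sum>k<rk. l k *\<^sub>R f k) \<odot> flow f l b t))
        \<le> C * (s - t)\<^sup>2"
proof -
  define m where "m i j = (l i + l j) / 2" for i j
  define R where "R s t i j = exp (s * m i j) - exp (t * m i j) - (s - t) * (m i j * exp (t * m i j))"
    for s t i j
  obtain C where C: "\<And>i j. 0 \<le> C i j"
    "\<And>i j s t. 0 \<le> s \<Longrightarrow> s \<le> 1 \<Longrightarrow> 0 \<le> t \<Longrightarrow> t \<le> 1 \<Longrightarrow> \<bar>R s t i j\<bar> \<le> C i j * (s - t)\<^sup>2"
    using exp_second_order[of "m _ _"] unfolding R_def by metis
  define D where "D = (\<Sum>i<rk. \<Sum>j<rk. C i j * norm (peirce f i j b))"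
  show ?thesis
  proof (rule that[of D])
    show "0 \<le> D"
      unfolding D_def using C(1) by (intro sum_nonneg mult_nonneg_nonneg) auto
    fix s t :: real
    assume st: "0 \<le> s" "s \<le> 1" "0 \<le> t" "t \<le> 1"
    define A where "A = (\<Sum>k<rk. l k *\<^sub>R f k)"
    have gen: "A \<odot> flow f l b t = (\<Sum>i<rk. \<Sum>j<rk. (m i j * exp (t * m i j)) *\<^sub>R peirce f i j b)"
      unfolding flow_expand jp_sum_right A_def m_def
      using peirce_generator[OF f] by (intro sum.cong refl) (simp add: mult.commute)
    have "flow f l b s - flow f l b t - (s - t) *\<^sub>R (A \<odot> flow f l b t)
        = (\<Sum>i<rk. \<Sum>j<rk. R s t i j *\<^sub>R peirce f i j b)"
      unfolding gen unfolding flow_expand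
      by (simp add: R_def m_def scaleR_diff_left sum_subtractf scaleR_sum_right)
    also have "norm \<dots> \<le> (\<Sum>i<rk. \<Sum>j<rk. \<bar>R s t i j\<bar> * norm (peirce f i j b))"
      by (intro sum_norm_le order_trans[OF norm_sum] sum_mono) simp
    also have "\<dots> \<le> (\<Sum>i<rk. \<Sum>j<rk. (C i j * (s - t)\<^sup>2) * norm (peirce f i j b))"
      using C(2) st by (intro sum_mono mult_right_mono) auto
    also have "\<dots> = D * (s - t)\<^sup>2"
      unfolding D_def sum_distrib_right by (simp add: mult_ac)
    finally show "norm (flow f l b s - flow f l b t - (s - t) *\<^sub>R ((\<Sum>k<rk. l k *\<^sub>R f k) \<odot> flow f l b t))
        \<le> D * (s - t)\<^sup>2"
      by (simp add: A_def)
  qed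
qed

text \<open>Pair the expansion with an element \<open>c i\<close> of a frame diagonalising the flow
  at \<open>t\<close>. Moving the product across the inner product turns the derivative into an
  eigenvalue times \<open>inner (c i) A\<close>. As frame elements have norm 1, one constant serves
  all frames.\<close>

lemma flow_eigenvector_step:
  assumes f: "frame_seq f"
  obtains C where "0 \<le> C"
    "\<And>s t c i. 0 \<le> s \<Longrightarrow> s \<le> 1 \<Longrightarrow> 0 \<le> t \<Longrightarrow> t \<le> 1 \<Longrightarrow> frame_seq c \<Longrightarrow> i < rk \<Longrightarrow>
      flow f l b t = (\<Sum>j<rk. ev (flow f l b t) j *\<^sub>R c j) \<Longrightarrow>
      inner (c i) (flow f l b s) \<le> ev (flow f l b t) i
        + (s - t) * (ev (flow f l b t) i * inner (c i) (\<Sum>k<rk. l k *\<^sub>R f k)) + C * (s - t)\<^sup>2"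
proof -
  define A where "A = (\<Sum>k<rk. l k *\<^sub>R f k)"
  obtain C where C: "0 \<le> C"
    "\<And>s t. 0 \<le> s \<Longrightarrow> s \<le> 1 \<Longrightarrow> 0 \<le> t \<Longrightarrow> t \<le> 1 \<Longrightarrow>
      norm (flow f l b s - flow f l b t - (s - t) *\<^sub>R (A \<odot> flow f l b t)) \<le> C * (s - t)\<^sup>2"
    using flow_second_order[OF f, of l b] unfolding A_def by blast
  show ?thesis
  proof (rule that[OF C(1)])
    fix s t :: real and c :: "nat \<Rightarrow> 'a" and i
    assume st: "0 \<le> s" "s \<le> 1" "0 \<le> t" "t \<le> 1" and c: "frame_seq c" and i: "i < rk"
      and eq: "flow f l b t = (\<Sum>j<rk. ev (flow f l b t) j *\<^sub>R c j)"
    define B where "B = flow f l b t"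
    define E where "E = flow f l b s - B - (s - t) *\<^sub>R (A \<odot> B)"
    have B: "B = (\<Sum>j<rk. ev B j *\<^sub>R c j)"
      unfolding B_def by (rule eq)
    have "B \<odot> c i = ev B i *\<^sub>R c i"
      by (subst B) (rule frame_eigenvector[OF c i])
    then have "inner (c i) (A \<odot> B) = ev B i * inner (c i) A"
      using inner_jp_swap[of A B "c i"] by (simp add: inner_commute)
    moreover have "inner (c i) B = ev B i"
      by (rule eigenvalue_frame_inner[OF c B i])
    moreover have "flow f l b s = B + (s - t) *\<^sub>R (A \<odot> B) + E"
      by (simp add: E_def)
    moreover have "inner (c i) E \<le> C * (s - t)\<^sup>2"
      using norm_cauchy_schwarz[of "c i" E] C(2)[OF st] frame_norm[OF c i] by (simp add: E_def B_def)
    ultimately show "inner (c i) (flow f l b s) \<le> ev (flow f l b t) i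
        + (s - t) * (ev (flow f l b t) i * inner (c i) (\<Sum>k<rk. l k *\<^sub>R f k)) + C * (s - t)\<^sup>2"
      by (simp add: inner_add_right flip: B_def A_def)
  qed
qed

text \<open>Gronwall argument for the least eigenvalue \<open>m\<close>: going back from
  \<open>t\<close> to \<open>s\<close> raises its positive part by at most the factor
  \<open>exp (K * (t - s))\<close> up to a quadratic error, so \<open>g 0 <= g T\<close>. The
  positive part is used because the sign of \<open>m\<close> is not yet known.\<close>

lemma flow_positive:
  assumes f: "frame_seq f" and b: "\<And>i. i < rk \<Longrightarrow> 0 < ev b i"
  obtains \<delta> where "0 < \<delta>"
    "\<And>t i. 0 \<le> t \<Longrightarrow> t \<le> 1 \<Longrightarrow> i < rk \<Longrightarrow> \<delta> \<le> ev (flow f l b t) i"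
proof -
  define A where "A = (\<Sum>k<rk. l k *\<^sub>R f k)"
  define K where "K = norm A"
  define m where "m t = ev (flow f l b t) (rk - 1)" for t
  define g where "g t = exp (K * t) * max 0 (m t)" for t
  have last: "rk - 1 < rk"
    using rank_pos by simp
  obtain C where C: "0 \<le> C"
    "\<And>s t c i. 0 \<le> s \<Longrightarrow> s \<le> 1 \<Longrightarrow> 0 \<le> t \<Longrightarrow> t \<le> 1 \<Longrightarrow> frame_seq c \<Longrightarrow> i < rk \<Longrightarrow>
      flow f l b t = (\<Sum>j<rk. ev (flow f l b t) j *\<^sub>R c j) \<Longrightarrow>
      inner (c i) (flow f l b s) \<le> ev (flow f l b t) i
        + (s - t) * (ev (flow f l b t) i * inner (c i) A) + C * (s - t)\<^sup>2"
    using flow_eigenvector_step[OF f, of l b] unfolding A_def by blast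
  have step: "max 0 (m s) \<le> max 0 (m t) * exp (K * (t - s)) + C * (t - s)\<^sup>2"
    if st: "0 \<le> s" "s \<le> t" "t \<le> 1" "t - s \<le> 1 / (K + 1)" for s t
  proof -
    define h where "h = t - s"
    have h: "0 \<le> h" "h * K \<le> 1"
    proof -
      show "0 \<le> h"
        using st by (simp add: h_def)
      have "0 < K + 1"
        by (simp add: K_def add_nonneg_pos)
      then have "h * (K + 1) \<le> 1"
        using st(4) by (simp add: h_def pos_le_divide_eq)
      then show "h * K \<le> 1"
        using \<open>0 \<le> h\<close> by (simp add: algebra_simps)
    qed
    obtain c where c: "frame_seq c" and eq: "flow f l b t = (\<Sum>j<rk. ev (flow f l b t) j *\<^sub>R c j)"
      using spectral_sequence by blast
    define p where "p = inner (c (rk - 1)) A"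
    have "\<bar>p\<bar> \<le> K"
      using Cauchy_Schwarz_ineq2[of "c (rk - 1)" A] frame_norm[OF c last] by (simp add: p_def K_def)
    then have "\<bar>h * p\<bar> \<le> h * K"
      using h(1) by (simp add: abs_mult mult_left_mono)
    have "m s \<le> inner (c (rk - 1)) (flow f l b s)"
      unfolding m_def by (rule eigenvalue_le_frame_inner[OF c last])
    also have "\<dots> \<le> m t + (s - t) * (m t * p) + C * (s - t)\<^sup>2"
      unfolding m_def p_def using st by (intro C(2) c last eq) auto
    also have "\<dots> = m t * (1 - h * p) + C * h\<^sup>2"
      by (simp add: h_def algebra_simps power2_commute)
    \<comment> \<open>The step bound \<open>1 / (K + 1)\<close> was chosen to give
      \<open>h * K <= 1\<close>, so the factor \<open>1 - h * p\<close> is nonnegative.\<close>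
    also have "m t * (1 - h * p) \<le> max 0 (m t) * (1 - h * p)"
      using \<open>\<bar>h * p\<bar> \<le> h * K\<close> h(2) by (intro mult_right_mono) auto
    also have "\<dots> \<le> max 0 (m t) * exp (K * h)"
    proof (rule mult_left_mono)
      have "1 - h * p \<le> 1 + K * h"
        using \<open>\<bar>h * p\<bar> \<le> h * K\<close> by (simp add: mult.commute abs_le_iff)
      also have "\<dots> \<le> exp (K * h)"
        by (rule exp_ge_add_one_self)
      finally show "1 - h * p \<le> exp (K * h)" .
    qed simp
    finally have "m s \<le> max 0 (m t) * exp (K * h) + C * h\<^sup>2"
      by simp
    moreover have "0 \<le> max 0 (m t) * exp (K * h) + C * h\<^sup>2"
      using C(1) by simp
    ultimately show ?thesis
      by (simp add: h_def)
  qed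
  have mono: "g 0 \<le> g T" if T: "0 \<le> T" "T \<le> 1" for T
  proof (rule le_of_quadratic_defect[where C = "exp K * C" and \<delta> = "1 / (K + 1)"])
    fix s t
    assume st: "0 \<le> s" "s \<le> t" "t \<le> T" "t - s \<le> 1 / (K + 1)"
    have "g s \<le> exp (K * s) * (max 0 (m t) * exp (K * (t - s)) + C * (t - s)\<^sup>2)"
      unfolding g_def using st T by (intro mult_left_mono step) auto
    also have "\<dots> = g t + exp (K * s) * (C * (t - s)\<^sup>2)"
      by (simp add: g_def algebra_simps flip: exp_add)
    also have "exp (K * s) * (C * (t - s)\<^sup>2) \<le> exp K * (C * (t - s)\<^sup>2)"
    proof (rule mult_right_mono)
      show "exp (K * s) \<le> exp K"
        using st T by (simp add: K_def mult_left_le)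
    qed (use C(1) in simp)
    finally show "g s \<le> g t + exp K * C * (t - s)\<^sup>2"
      by (simp add: mult.assoc)
  qed (use T in \<open>auto simp: K_def add_nonneg_pos\<close>)
  have "0 < g 0"
    using b[OF last] by (simp add: g_def m_def flow_0[OF f])
  show ?thesis
  proof (rule that[of "g 0 / exp K"])
    show "0 < g 0 / exp K"
      using \<open>0 < g 0\<close> by simp
    fix t :: real and i
    assume t: "0 \<le> t" "t \<le> 1" and i: "i < rk"
    have "exp (K * t) \<le> exp K"
      using t by (simp add: K_def mult_left_le)
    then have "g t \<le> exp K * max 0 (m t)"
      unfolding g_def by (intro mult_right_mono) auto
    then have "g 0 / exp K \<le> max 0 (m t)"
      using mono[OF t] by (simp add: field_simps)
    then have "g 0 / exp K \<le> m t"
      using \<open>0 < g 0 / exp K\<close> by linarith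
    also have "\<dots> \<le> ev (flow f l b t) i"
      unfolding m_def using i by (intro ev_antimono) auto
    finally show "g 0 / exp K \<le> ev (flow f l b t) i" .
  qed
qed

text \<open>Jensen's inequality in a frame for time \<open>t\<close> is followed by
  \<open>ln z <= ln y + z / y - 1\<close>; dividing by the eigenvalue \<open>y\<close> cancels it
  from the first-order term, and the lower bound on \<open>y\<close> controls the error. The order
  of \<open>s\<close> and \<open>t\<close> is left free because steps in both directions are taken
  later.\<close>

lemma flow_sum_ln_step:
  assumes f: "frame_seq f" and b: "\<And>i. i < rk \<Longrightarrow> 0 < ev b i" and k: "k \<le> rk"
  obtains C where
    "\<And>s t. 0 \<le> s \<Longrightarrow> s \<le> 1 \<Longrightarrow> 0 \<le> t \<Longrightarrow> t \<le> 1 \<Longrightarrow> \<exists>c. frame_seq c \<and>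
      (\<Sum>i=k..<rk. ln (ev (flow f l b s) i)) \<le> (\<Sum>i=k..<rk. ln (ev (flow f l b t) i))
        + (s - t) * (\<Sum>i=k..<rk. inner (c i) (\<Sum>k<rk. l k *\<^sub>R f k)) + C * (s - t)\<^sup>2"
proof -
  define A where "A = (\<Sum>k<rk. l k *\<^sub>R f k)"
  obtain C where C: "0 \<le> C"
    "\<And>s t c i. 0 \<le> s \<Longrightarrow> s \<le> 1 \<Longrightarrow> 0 \<le> t \<Longrightarrow> t \<le> 1 \<Longrightarrow> frame_seq c \<Longrightarrow> i < rk \<Longrightarrow>
      flow f l b t = (\<Sum>j<rk. ev (flow f l b t) j *\<^sub>R c j) \<Longrightarrow>
      inner (c i) (flow f l b s) \<le> ev (flow f l b t) i
        + (s - t) * (ev (flow f l b t) i * inner (c i) A) + C * (s - t)\<^sup>2"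
    using flow_eigenvector_step[OF f, of l b] unfolding A_def by blast
  obtain \<delta> where \<delta>: "0 < \<delta>"
    "\<And>t i. 0 \<le> t \<Longrightarrow> t \<le> 1 \<Longrightarrow> i < rk \<Longrightarrow> \<delta> \<le> ev (flow f l b t) i"
    using flow_positive[OF f b] by blast
  show ?thesis
  proof (rule that[of "real (rk - k) * (C / \<delta>)"])
    fix s t :: real
    assume st: "0 \<le> s" "s \<le> 1" "0 \<le> t" "t \<le> 1"
    obtain c where c: "frame_seq c" and eq: "flow f l b t = (\<Sum>j<rk. ev (flow f l b t) j *\<^sub>R c j)"
      using spectral_sequence by blast
    have pos: "0 < ev (flow f l b s) i" if "i < rk" for i
      using \<delta>(2)[OF st(1,2) that] \<delta>(1) by linarith
    have "(\<Sum>i=k..<rk. ln (ev (flow f l b s) i)) \<le> (\<Sum>i=k..<rk. ln (inner (c i) (flow f l b s)))"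
      by (rule sum_ln_eigenvalues_le[OF c k pos])
    also have "\<dots> \<le> (\<Sum>i=k..<rk. ln (ev (flow f l b t) i) + (s - t) * inner (c i) A + C / \<delta> * (s - t)\<^sup>2)"
    proof (rule sum_mono)
      fix i assume "i \<in> {k..<rk}"
      then have i: "i < rk" by simp
      define y where "y = ev (flow f l b t) i"
      define z where "z = inner (c i) (flow f l b s)"
      have y: "\<delta> \<le> y" "0 < y"
        using \<delta>(2)[OF st(3,4) i] \<delta>(1) by (auto simp: y_def)
      have "0 < z"
        using eigenvalue_le_frame_inner[OF c i, of "flow f l b s"] pos[of "rk - 1"] rank_pos
        by (simp add: z_def)
      have "z \<le> y + (s - t) * (y * inner (c i) A) + C * (s - t)\<^sup>2"
        unfolding z_def y_def by (intro C(2) st c i eq)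
      then have "z / y \<le> (y + (s - t) * (y * inner (c i) A) + C * (s - t)\<^sup>2) / y"
        using y(2) by (intro divide_right_mono) auto
      also have "\<dots> = 1 + (s - t) * inner (c i) A + C * (s - t)\<^sup>2 / y"
        using y(2) by (simp add: add_divide_distrib)
      also have "C * (s - t)\<^sup>2 / y \<le> C * (s - t)\<^sup>2 / \<delta>"
        using y \<delta>(1) C(1) by (intro divide_left_mono) auto
      finally have "z / y \<le> 1 + (s - t) * inner (c i) A + C / \<delta> * (s - t)\<^sup>2"
        by simp
      moreover have "ln (z / y) \<le> z / y - 1"
        using \<open>0 < z\<close> y(2) by (intro ln_le_minus_one) simp
      ultimately have "ln z \<le> ln y + (s - t) * inner (c i) A + C / \<delta> * (s - t)\<^sup>2"
        using \<open>0 < z\<close> y(2) by (simp add: ln_div)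
      then show "ln (inner (c i) (flow f l b s))
          \<le> ln (ev (flow f l b t) i) + (s - t) * inner (c i) A + C / \<delta> * (s - t)\<^sup>2"
        by (simp add: z_def y_def)
    qed
    also have "\<dots> = (\<Sum>i=k..<rk. ln (ev (flow f l b t) i)) + (s - t) * (\<Sum>i=k..<rk. inner (c i) A)
        + real (rk - k) * (C / \<delta>) * (s - t)\<^sup>2"
      by (simp add: sum.distrib sum_distrib_left)
    finally show "\<exists>c. frame_seq c \<and>
      (\<Sum>i=k..<rk. ln (ev (flow f l b s) i)) \<le> (\<Sum>i=k..<rk. ln (ev (flow f l b t) i))
        + (s - t) * (\<Sum>i=k..<rk. inner (c i) (\<Sum>k<rk. l k *\<^sub>R f k)) + real (rk - k) * (C / \<delta>) * (s - t)\<^sup>2"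
      using c by (auto simp: A_def)
  qed
qed

text \<open>Stepping backwards makes \<open>s - t\<close> nonpositive, so the lower bound of
  \<open>ky_fan_bottom\<close> becomes the required upper bound on \<open>G s\<close>.\<close>

lemma flow_sum_ln_lower:
  assumes f: "frame_seq f" and b: "\<And>i. i < rk \<Longrightarrow> 0 < ev b i" and k: "k \<le> rk"
    and dec: "\<And>i j. i \<le> j \<Longrightarrow> j < rk \<Longrightarrow> l j \<le> l i"
  shows "(\<Sum>i=k..<rk. ln (ev b i)) + (\<Sum>i=k..<rk. l i) \<le> (\<Sum>i=k..<rk. ln (ev (flow f l b 1) i))"
proof -
  define G where "G t = (\<Sum>i=k..<rk. ln (ev (flow f l b t) i))" for t
  define L where "L = (\<Sum>i=k..<rk. l i)"
  obtain C where C: "\<And>s t. 0 \<le> s \<Longrightarrow> s \<le> 1 \<Longrightarrow> 0 \<le> t \<Longrightarrow> t \<le> 1 \<Longrightarrow> \<exists>c. frame_seq c \<and>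
      G s \<le> G t + (s - t) * (\<Sum>i=k..<rk. inner (c i) (\<Sum>k<rk. l k *\<^sub>R f k)) + C * (s - t)\<^sup>2"
    using flow_sum_ln_step[OF f b k, of l] unfolding G_def by blast
  have "G 0 - 0 * L \<le> G 1 - 1 * L"
  proof (rule le_of_quadratic_defect[where \<delta> = 1 and C = C])
    fix s t :: real
    assume st: "0 \<le> s" "s \<le> t" "t \<le> 1"
    obtain c where c: "frame_seq c" and
      le: "G s \<le> G t + (s - t) * (\<Sum>i=k..<rk. inner (c i) (\<Sum>k<rk. l k *\<^sub>R f k)) + C * (s - t)\<^sup>2"
      using C[of s t] st by auto
    have "L \<le> (\<Sum>i=k..<rk. inner (c i) (\<Sum>k<rk. l k *\<^sub>R f k))"
      unfolding L_def by (rule ky_fan_bottom[OF c f k dec])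
    then have "(s - t) * (\<Sum>i=k..<rk. inner (c i) (\<Sum>k<rk. l k *\<^sub>R f k)) \<le> (s - t) * L"
      using st by (intro mult_left_mono_neg) auto
    then show "G s - s * L \<le> G t - t * L + C * (t - s)\<^sup>2"
      using le by (simp add: algebra_simps power2_commute)
  qed auto
  then show ?thesis
    by (simp add: G_def L_def flow_0[OF f])
qed

text \<open>For the full sum the first-order coefficient is the trace of the logarithm of
  \<open>a\<close> in every frame, so a forward step works as well and yields the reverse
  inequality.\<close>

lemma flow_sum_ln_upper:
  assumes f: "frame_seq f" and b: "\<And>i. i < rk \<Longrightarrow> 0 < ev b i"
  shows "(\<Sum>i<rk. ln (ev (flow f l b 1) i)) \<le> (\<Sum>i<rk. ln (ev b i)) + (\<Sum>i<rk. l i)"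
proof -
  define G where "G t = (\<Sum>i=0..<rk. ln (ev (flow f l b t) i))" for t
  define L where "L = (\<Sum>i<rk. l i)"
  obtain C where C: "\<And>s t. 0 \<le> s \<Longrightarrow> s \<le> 1 \<Longrightarrow> 0 \<le> t \<Longrightarrow> t \<le> 1 \<Longrightarrow> \<exists>c. frame_seq c \<and>
      G s \<le> G t + (s - t) * (\<Sum>i=0..<rk. inner (c i) (\<Sum>k<rk. l k *\<^sub>R f k)) + C * (s - t)\<^sup>2"
    using flow_sum_ln_step[OF f b, of 0 l] unfolding G_def by blast
  have "0 * L - G 0 \<le> 1 * L - G 1"
  proof (rule le_of_quadratic_defect[where \<delta> = 1 and C = C])
    fix s t :: real
    assume st: "0 \<le> s" "s \<le> t" "t \<le> 1"
    obtain c where c: "frame_seq c" and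
      le: "G t \<le> G s + (t - s) * (\<Sum>i=0..<rk. inner (c i) (\<Sum>k<rk. l k *\<^sub>R f k)) + C * (t - s)\<^sup>2"
      using C[of t s] st by auto
    have "(\<Sum>i=0..<rk. inner (c i) (\<Sum>k<rk. l k *\<^sub>R f k)) = L"
      unfolding L_def atLeast0LessThan by (rule frame_trace[OF c f])
    then show "s * L - G s \<le> t * L - G t + C * (t - s)\<^sup>2"
      using le by (simp add: algebra_simps)
  qed auto
  then show ?thesis
    by (simp add: G_def L_def flow_0[OF f] atLeast0LessThan)
qed

end

section \<open>Log-majorization\<close>

context trace_jordan_algebra
begin

text \<open>Equal totals convert lower bounds on the sums of the smallest logarithms into upper
  bounds on the sums of the largest ones; exponentiation gives the products.\<close>

lemma flow_prod_eigenvalues: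
  assumes f: "frame_seq f" and b: "\<And>i. i < rk \<Longrightarrow> 0 < ev b i"
    and dec: "\<And>i j. i \<le> j \<Longrightarrow> j < rk \<Longrightarrow> l j \<le> l i"
  shows "\<And>i. i < rk \<Longrightarrow> 0 < ev (flow f l b 1) i"
    and "\<And>k. k \<le> rk \<Longrightarrow> (\<Prod>i<k. ev (flow f l b 1) i) \<le> (\<Prod>i<k. exp (l i) * ev b i)"
    and "(\<Prod>i<rk. ev (flow f l b 1) i) = (\<Prod>i<rk. exp (l i) * ev b i)"
proof -
  obtain \<delta> where "0 < \<delta>"
    "\<And>t i. 0 \<le> t \<Longrightarrow> t \<le> 1 \<Longrightarrow> i < rk \<Longrightarrow> \<delta> \<le> ev (flow f l b t) i"
    using flow_positive[OF f b] by blast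
  then show pos: "0 < ev (flow f l b 1) i" if "i < rk" for i
    using that by (meson less_le_trans order_refl zero_le_one)
  define P where "P i = ln (ev (flow f l b 1) i)" for i
  define Q where "Q i = ln (ev b i) + l i" for i
  have lower: "(\<Sum>i=k..<rk. Q i) \<le> (\<Sum>i=k..<rk. P i)" if "k \<le> rk" for k
    using flow_sum_ln_lower[OF f b that dec] by (simp add: P_def Q_def sum.distrib)
  have upper: "(\<Sum>i<rk. P i) \<le> (\<Sum>i<rk. Q i)"
    using flow_sum_ln_upper[OF f b, of l] by (simp add: P_def Q_def sum.distrib)
  have total: "(\<Sum>i<rk. P i) = (\<Sum>i<rk. Q i)"
    using lower[of 0] upper by (simp add: atLeast0LessThan)
  have prod: "(\<Prod>i<k. ev (flow f l b 1) i) = exp (\<Sum>i<k. P i)"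
    "(\<Prod>i<k. exp (l i) * ev b i) = exp (\<Sum>i<k. Q i)" if "k \<le> rk" for k
    using that pos b by (simp_all add: exp_sum P_def Q_def exp_add mult.commute)
  show "(\<Prod>i<k. ev (flow f l b 1) i) \<le> (\<Prod>i<k. exp (l i) * ev b i)" if k: "k \<le> rk" for k
    using lower[OF k] total by (simp add: prod[OF k] sum_tail[OF k])
  show "(\<Prod>i<rk. ev (flow f l b 1) i) = (\<Prod>i<rk. exp (l i) * ev b i)"
    using total by (simp add: prod)
qed

lemma eigenvalue_shift_pos:
  assumes b: "\<And>i. i < rk \<Longrightarrow> 0 \<le> ev b i" and \<epsilon>: "0 < \<epsilon>" and i: "i < rk"
  shows "0 < ev (b + \<epsilon> *\<^sub>R e) i"
proof -
  obtain c where c: "frame_seq c" and eq: "b + \<epsilon> *\<^sub>R e = (\<Sum>j<rk. ev (b + \<epsilon> *\<^sub>R e) j *\<^sub>R c j)"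
    using spectral_sequence by blast
  have "ev (b + \<epsilon> *\<^sub>R e) i = inner (c i) b + \<epsilon>"
    using eigenvalue_frame_inner[OF c eq i] c i by (simp add: inner_add_right frame_seq_def)
  moreover have "0 \<le> inner (c i) b"
    using eigenvalue_le_frame_inner[OF c i, of b] b[of "rk - 1"] rank_pos by simp
  ultimately show ?thesis
    using \<epsilon> by simp
qed

lemma tendsto_quadratic_rep:
  assumes "(U \<longlongrightarrow> u) G" "(X \<longlongrightarrow> x) G"
  shows "((\<lambda>t. quadratic_rep jp (U t) (X t)) \<longlongrightarrow> quadratic_rep jp u x) G"
proof -
  have bounded: "bounded_bilinear (\<odot>)"
    using bilinear by (simp add: bilinear_conv_bounded_bilinear)
  show ?thesis
    unfolding quadratic_rep_def
    by (intro tendsto_intros bounded_bilinear.tendsto[OF bounded] assms)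
qed

text \<open>Adding \<open>\<epsilon> N\<close> to the coefficients \<open>\<alpha>\<close> and
  \<open>\<epsilon> N *\<^sub>R e\<close> to \<open>b\<close> reaches the positive definite case;
  eigenvalues and the quadratic representation are continuous, so the relations pass to the
  limit.\<close>

lemma quadratic_rep_prod_eigenvalues:
  assumes f: "frame_seq f"
    and a: "\<And>i. i < rk \<Longrightarrow> 0 \<le> \<alpha> i" and dec: "\<And>i j. i \<le> j \<Longrightarrow> j < rk \<Longrightarrow> \<alpha> j \<le> \<alpha> i"
    and b: "\<And>i. i < rk \<Longrightarrow> 0 \<le> ev b i"
    and B: "B = quadratic_rep jp (\<Sum>i<rk. sqrt (\<alpha> i) *\<^sub>R f i) b"
  shows "\<And>i. i < rk \<Longrightarrow> 0 \<le> ev B i"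
    and "\<And>k. k \<le> rk \<Longrightarrow> (\<Prod>i<k. ev B i) \<le> (\<Prod>i<k. \<alpha> i * ev b i)"
    and "(\<Prod>i<rk. ev B i) = (\<Prod>i<rk. \<alpha> i * ev b i)"
proof -
  define \<epsilon> where "\<epsilon> N = inverse (real (Suc N))" for N
  have \<epsilon>: "0 < \<epsilon> N" for N
    by (simp add: \<epsilon>_def)
  have \<epsilon>0: "\<epsilon> \<longlonglongrightarrow> 0"
    unfolding \<epsilon>_def by (rule LIMSEQ_inverse_real_of_nat)
  define l where "l N i = ln (\<alpha> i + \<epsilon> N)" for N i
  define b' where "b' N = b + \<epsilon> N *\<^sub>R e" for N
  define B' where "B' N = flow f (l N) (b' N) 1" for N
  have pos: "0 < \<alpha> i + \<epsilon> N" if "i < rk" for i N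
    using a[OF that] \<epsilon>[of N] by linarith
  have b'pos: "0 < ev (b' N) i" if "i < rk" for i N
    unfolding b'_def using b \<epsilon> that by (intro eigenvalue_shift_pos) auto
  have ldec: "l N j \<le> l N i" if "i \<le> j" "j < rk" for N i j
    unfolding l_def using dec[OF that] pos[of i N] pos[of j N] that by simp
  have approx: "i < rk \<Longrightarrow> 0 < ev (B' N) i"
    "k \<le> rk \<Longrightarrow> (\<Prod>i<k. ev (B' N) i) \<le> (\<Prod>i<k. exp (l N i) * ev (b' N) i)"
    "(\<Prod>i<rk. ev (B' N) i) = (\<Prod>i<rk. exp (l N i) * ev (b' N) i)" for i k N
    unfolding B'_def using flow_prod_eigenvalues[OF f, of "b' N" "l N"] b'pos ldec by blast+
  have b'lim: "b' \<longlonglongrightarrow> b"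
    unfolding b'_def using \<epsilon>0 by (auto intro!: tendsto_eq_intros)
  have sqrt: "exp (1 * l N i / 2) = sqrt (\<alpha> i + \<epsilon> N)" if "i < rk" for i N
    using pos[OF that, of N] powr_half_sqrt[of "\<alpha> i + \<epsilon> N"] by (simp add: l_def powr_def)
  have "B' = (\<lambda>N. quadratic_rep jp (\<Sum>i<rk. sqrt (\<alpha> i + \<epsilon> N) *\<^sub>R f i) (b' N))"
    unfolding B'_def flow_def using sqrt by simp
  moreover have "(\<lambda>N. quadratic_rep jp (\<Sum>i<rk. sqrt (\<alpha> i + \<epsilon> N) *\<^sub>R f i) (b' N))
      \<longlonglongrightarrow> quadratic_rep jp (\<Sum>i<rk. sqrt (\<alpha> i + 0) *\<^sub>R f i) b"
    by (intro tendsto_quadratic_rep b'lim tendsto_sum tendsto_scaleR tendsto_const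
        tendsto_real_sqrt tendsto_add \<epsilon>0)
  ultimately have B'lim: "B' \<longlonglongrightarrow> B"
    by (simp add: B)
  have lhs: "(\<lambda>N. \<Prod>i<k. ev (B' N) i) \<longlonglongrightarrow> (\<Prod>i<k. ev B i)" if "k \<le> rk" for k
    using that B'lim by (intro tendsto_prod tendsto_eigenvalue) auto
  have rhs: "(\<lambda>N. \<Prod>i<k. exp (l N i) * ev (b' N) i) \<longlonglongrightarrow> (\<Prod>i<k. \<alpha> i * ev b i)" if k: "k \<le> rk" for k
  proof (intro tendsto_prod tendsto_mult)
    fix i assume "i \<in> {..<k}"
    then have i: "i < rk"
      using k by simp
    show "(\<lambda>N. ev (b' N) i) \<longlonglongrightarrow> ev b i"
      by (rule tendsto_eigenvalue[OF b'lim i])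
    have "(\<lambda>N. \<alpha> i + \<epsilon> N) \<longlonglongrightarrow> \<alpha> i + 0"
      by (intro tendsto_add tendsto_const \<epsilon>0)
    \<comment> \<open>By positivity \<open>exp (l N i)\<close> equals
      \<open>\<alpha> i + \<epsilon> N\<close>, so the limit is valid even where
      \<open>\<alpha> i = 0\<close> and the logarithms diverge.\<close>
    then show "(\<lambda>N. exp (l N i)) \<longlonglongrightarrow> \<alpha> i"
      using pos[OF i] by (simp add: l_def)
  qed
  show "0 \<le> ev B i" if "i < rk" for i
    using tendsto_eigenvalue[OF B'lim that] approx(1)[OF that]
    by (intro LIMSEQ_le_const) (auto intro: less_imp_le)
  show "(\<Prod>i<k. ev B i) \<le> (\<Prod>i<k. \<alpha> i * ev b i)" if k: "k \<le> rk" for k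
    using approx(2)[OF k] by (intro LIMSEQ_le[OF lhs[OF k] rhs[OF k]]) auto
  show "(\<Prod>i<rk. ev B i) = (\<Prod>i<rk. \<alpha> i * ev b i)"
    using LIMSEQ_unique[OF lhs[of rk]] rhs[of rk] by (simp add: approx(3))
qed

end

section \<open>From indexed products to the majorization relations\<close>

lemma decreasing_rearrangement_id:
  assumes "\<And>i j. i \<le> j \<Longrightarrow> j < length p \<Longrightarrow> p ! j \<le> p ! i"
  shows "decreasing_rearrangement p = p"
proof -
  have "sorted (rev p)"
    using assms by (simp add: sorted_rev_iff_nth_mono)
  then have "sort p = rev p"
    by (intro properties_for_sort) simp_all
  then show ?thesis
    by (simp add: decreasing_rearrangement_def)
qed

lemma prod_list_take_nth: "k \<le> length p \<Longrightarrow> prod_list (take k p) = (\<Prod>i<k. p ! i)"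
  by (induction k) (simp_all add: take_Suc_conv_app_nth mult.commute)

lemma sum_list_take_nth: "k \<le> length p \<Longrightarrow> sum_list (take k p) = (\<Sum>i<k. p ! i)"
  by (induction k) (simp_all add: take_Suc_conv_app_nth add.commute)

theorem theorem3p4:
  fixes jp :: "'a::euclidean_space \<Rightarrow> 'a \<Rightarrow> 'a" and e a b :: 'a and n :: nat
  assumes "euclidean_jordan_algebra jp e"
    and "\<And>x y. inner x y = jordan_trace jp e (jp x y)"
    and "jordan_rank jp e = n"
    and "jordan_nonneg jp e a"
    and "jordan_nonneg jp e b"
  shows "log_majorized n
           (eigenvalue_vector jp e (quadratic_rep jp (jordan_sqrt jp e a) b))
           (componentwise_product (eigenvalue_vector jp e a) (eigenvalue_vector jp e b))
       \<and> weakly_majorized n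
           (eigenvalue_vector jp e (quadratic_rep jp (jordan_sqrt jp e a) b))
           (componentwise_product (eigenvalue_vector jp e a) (eigenvalue_vector jp e b))"
proof -
  interpret trace_jordan_algebra jp e
    using assms(1,2) by (intro trace_jordan_algebra.intro trace_jordan_algebra_axioms.intro)
  define B where "B = quadratic_rep jp (jordan_sqrt jp e a) b"
  define p where "p = eigenvalue_vector jp e B"
  define q where "q = componentwise_product (eigenvalue_vector jp e a) (eigenvalue_vector jp e b)"
  obtain f where f: "frame_seq f" and root: "jordan_sqrt jp e a = (\<Sum>i<rk. sqrt (ev a i) *\<^sub>R f i)"
    using spectral_sequence by blast
  note a = ev_nonneg[OF assms(4)] and b = ev_nonneg[OF assms(5)]
  have len: "length p = n" "length q = n"
    using length_eigenvalue_vector assms(3) by (simp_all add: p_def q_def componentwise_product_def)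
  have p: "p ! i = ev B i" for i
    by (simp add: p_def)
  have q: "q ! i = ev a i * ev b i" if "i < n" for i
    using that length_eigenvalue_vector assms(3) by (simp add: q_def componentwise_product_def)
  have major: "i < n \<Longrightarrow> 0 \<le> ev B i"
    "k \<le> n \<Longrightarrow> (\<Prod>i<k. ev B i) \<le> (\<Prod>i<k. ev a i * ev b i)"
    "(\<Prod>i<n. ev B i) = (\<Prod>i<n. ev a i * ev b i)" for i k
    using quadratic_rep_prod_eigenvalues[OF f, of "ev a" b B] a b ev_antimono B_def[unfolded root] assms(3)
    by blast+
  have p_dec: "p ! j \<le> p ! i" if "i \<le> j" "j < n" for i j
    using ev_antimono[of i j B] that assms(3) by (simp add: p)
  \<comment> \<open>A product of nonnegative decreasing vectors is decreasing, so the rearrangement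
    leaves \<open>q\<close> as it is.\<close>
  have q_dec: "q ! j \<le> q ! i" if "i \<le> j" "j < n" for i j
    using ev_antimono[of i j] a b that assms(3) by (simp add: q mult_mono)
  have p_nonneg: "0 \<le> p ! i" and q_nonneg: "0 \<le> q ! i" if "i < n" for i
    using major(1) a b that assms(3) by (simp_all add: p q)
  have le: "(\<Prod>i<k. p ! i) \<le> (\<Prod>i<k. q ! i)" if "k \<le> n" for k
    using major(2)[OF that] that by (simp add: p q)
  have eq: "(\<Prod>i<n. p ! i) = (\<Prod>i<n. q ! i)"
    using major(3) by (simp add: p q)
  have id: "decreasing_rearrangement p = p" "decreasing_rearrangement q = q"
    using p_dec q_dec len by (auto intro!: decreasing_rearrangement_id)
  have "log_majorized n p q"
    unfolding log_majorized_def id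
    using len le eq p_nonneg q_nonneg prod_list_take_nth[of n p] prod_list_take_nth[of n q]
    by (auto simp: prod_list_take_nth in_set_conv_nth)
  moreover have "(\<Sum>i<k. p ! i) \<le> (\<Sum>i<k. q ! i)" if "k \<le> n" for k
    using that p_dec p_nonneg q_nonneg le by (intro sum_le_sum_of_prod_le_prod) auto
  then have "weakly_majorized n p q"
    unfolding weakly_majorized_def id using len by (simp add: sum_list_take_nth)
  ultimately show ?thesis
    by (simp add: p_def q_def B_def)
qed

end
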